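(* $\mathrm{Rel}(\textsc{Dominating Set}, \mathrm{dist}_E, n/e)$ is in FP, where $e$ is Euler's number.
   Context: For a problem $\Pi$, a metric $\mathrm{dist}$ on its inputs, and a non-decreasing function $d:\mathbb N\to\mathbb R_+\cup\{\infty\}$, the function problem $\mathrm{Rel}(\Pi,\mathrm{dist},d)$ is: given an input $I$ of $\Pi$, output a pair $(J,\Pi(J))$ where $J$ is an input of $\Pi$ with $\mathrm{dist}(I,J)\le d(|I|)$ and $\Pi(J)$ is a correct answer to $\Pi$ on $J$ (a correct solution on $J$, or $\mathrm{nil}$ if none exists). For graph problems $|I|$ is the number of vertices $n$ of the input graph; $n/e$ denotes the function $n\mapsto n/e$. For graphs $G,H$: $\mathrm{dist}_E(G,H)=|E(G)\triangle E(H)|$ if $V(G)=V(H)$ and $\infty$ otherwise; $\mathrm{dist}_E((G,k),(H,\ell))=\mathrm{dist}_E(G,H)$ if $k=\ell$ and $\infty$ otherwise. \textsc{Dominating Set}: given a graph $G$ and an integer $k\in[0,|V(G)|]$, output a dominating set of $G$ of size $k$ (a set $S$ with $N_G[S]=V(G)$), or $\mathrm{nil}$ if none exists. FP is the class of function problems solvable in polynomial time. *)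

theory Defs
  imports Complex_Main "HOL-Library.Extended_Nonnegative_Real"
    "HOL-Computational_Algebra.Polynomial"
begin

section \<open>Function problems\<close>

record ('i, 'a) problem =
  inputs :: "'i set"
  input_size :: "'i \<Rightarrow> nat"
  correct :: "'i \<Rightarrow> 'a \<Rightarrow> bool"

text \<open>The answer \<open>None\<close> plays the role of nil.\<close>

definition search_problem :: "'i set \<Rightarrow> ('i \<Rightarrow> nat) \<Rightarrow> ('i \<Rightarrow> 's \<Rightarrow> bool) \<Rightarrow> ('i, 's option) problem" where
  "search_problem X sz sol =
     \<lparr> inputs = X, input_size = sz,
       correct = (\<lambda>I a. case a of Some s \<Rightarrow> sol I s | None \<Rightarrow> \<not> (\<exists>s. sol I s)) \<rparr>"

definition Rel ::
  "('i, 'a) problem \<Rightarrow> ('i \<Rightarrow> 'i \<Rightarrow> ennreal) \<Rightarrow> (nat \<Rightarrow> ennreal) \<Rightarrow> ('i, 'i \<times> 'a) problem" where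
  "Rel P D d =
     \<lparr> inputs = inputs P, input_size = input_size P,
       correct = (\<lambda>I (J, a). J \<in> inputs P \<and> D I J \<le> d (input_size P I) \<and> correct P J a) \<rparr>"

section \<open>Deterministic multi-tape Turing machines and FP\<close>

text \<open>
  States are \<open>0, \<dots>, Q\<close>, where \<open>0\<close> is initial and \<open>Q = tm_states M\<close> is the
  unique halting state. Tape symbols are \<open>0, \<dots>, tm_symbols M - 1\<close>, where \<open>0\<close> is the blank,
  \<open>1\<close> and \<open>2\<close> represent the bits \<open>False\<close> and \<open>True\<close>. Tapes are infinite in both
  directions; a tape consists of its contents and the head position. Only the finitely many values
  of \<open>tm_delta\<close> on non-halting states and lists of \<open>tm_tapes M\<close> tape symbols matter.
\<close>

datatype move = Lft | Stay | Rgt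

record tm =
  tm_tapes :: nat
  tm_symbols :: nat
  tm_states :: nat
  tm_delta :: "nat \<Rightarrow> nat list \<Rightarrow> nat \<times> (nat \<times> move) list"

definition wf_tm :: "tm \<Rightarrow> bool" where
  "wf_tm M \<longleftrightarrow> tm_tapes M \<ge> 1 \<and> tm_symbols M \<ge> 3 \<and>
     (\<forall>q < tm_states M. \<forall>ss. length ss = tm_tapes M \<and> set ss \<subseteq> {..<tm_symbols M} \<longrightarrow>
        (case tm_delta M q ss of (q', as) \<Rightarrow>
           q' \<le> tm_states M \<and> length as = tm_tapes M \<and> fst ` set as \<subseteq> {..<tm_symbols M}))"

type_synonym tape = "(int \<Rightarrow> nat) \<times> int"
type_synonym config = "nat \<times> tape list"

definition read :: "tape \<Rightarrow> nat" where
  "read t = fst t (snd t)"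

fun offset :: "move \<Rightarrow> int" where
  "offset Lft = -1"
| "offset Stay = 0"
| "offset Rgt = 1"

definition act :: "nat \<times> move \<Rightarrow> tape \<Rightarrow> tape" where
  "act a t = ((fst t)(snd t := fst a), snd t + offset (snd a))"

fun step :: "tm \<Rightarrow> config \<Rightarrow> config" where
  "step M (q, ts) =
     (if q < tm_states M
      then (case tm_delta M q (map read ts) of (q', as) \<Rightarrow> (q', map2 act as ts))
      else (q, ts))"

definition bit_symbol :: "bool \<Rightarrow> nat" where
  "bit_symbol b = (if b then 2 else 1)"

definition input_tape :: "bool list \<Rightarrow> tape" where
  "input_tape x =
     ((\<lambda>i. if 0 \<le> i \<and> i < int (length x) then bit_symbol (x ! nat i) else 0), 0)"

definition init_config :: "tm \<Rightarrow> bool list \<Rightarrow> config" where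
  "init_config M x = (0, input_tape x # replicate (tm_tapes M - 1) (input_tape []))"

definition tape_holds :: "tape \<Rightarrow> bool list \<Rightarrow> bool" where
  "tape_holds t y \<longleftrightarrow>
     (\<forall>i < length y. fst t (int i) = bit_symbol (y ! i)) \<and> fst t (int (length y)) = 0"

text \<open>The last tape is the output tape. Halting configurations are fixed points of \<open>step\<close>,
  so \<open>t\<close> is an upper bound on the running time.\<close>

definition outputs_within :: "tm \<Rightarrow> bool list \<Rightarrow> nat \<Rightarrow> bool list \<Rightarrow> bool" where
  "outputs_within M x t y \<longleftrightarrow>
     (case (step M ^^ t) (init_config M x) of (q, ts) \<Rightarrow> q = tm_states M \<and> tape_holds (last ts) y)"

definition FP :: "(bool list, bool list) problem set" where
  "FP = {P. \<exists>M (p :: nat poly). wf_tm M \<and>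
          (\<forall>x \<in> inputs P. \<exists>y. correct P x y \<and> outputs_within M x (poly p (length x)) y)}"

definition encode_problem ::
  "('i \<Rightarrow> bool list) \<Rightarrow> ('a \<Rightarrow> bool list) \<Rightarrow> ('i, 'a) problem \<Rightarrow> (bool list, bool list) problem" where
  "encode_problem enc_in enc_out P =
     \<lparr> inputs = enc_in ` inputs P, input_size = length,
       correct = (\<lambda>x y. \<exists>I \<in> inputs P. \<exists>a. x = enc_in I \<and> y = enc_out a \<and> correct P I a) \<rparr>"

section \<open>Graphs and dominating sets\<close>

record 'v graph =
  verts :: "'v set"
  edges :: "'v set set"

definition simple_graph :: "'v graph \<Rightarrow> bool" where
  "simple_graph G \<longleftrightarrow> finite (verts G) \<and> (\<forall>e \<in> edges G. e \<subseteq> verts G \<and> card e = 2)"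

definition dist_E :: "'v graph \<Rightarrow> 'v graph \<Rightarrow> ennreal" where
  "dist_E G H =
     (if verts G = verts H
      then of_nat (card ((edges G - edges H) \<union> (edges H - edges G))) else \<infinity>)"

definition dist_E_param :: "'v graph \<times> nat \<Rightarrow> 'v graph \<times> nat \<Rightarrow> ennreal" where
  "dist_E_param I J = (if snd I = snd J then dist_E (fst I) (fst J) else \<infinity>)"

definition closed_nbhd :: "'v graph \<Rightarrow> 'v set \<Rightarrow> 'v set" where
  "closed_nbhd G S = S \<union> {u. \<exists>v \<in> S. {u, v} \<in> edges G}"

definition dominating_set :: "'v graph \<Rightarrow> 'v set \<Rightarrow> bool" where
  "dominating_set G S \<longleftrightarrow> S \<subseteq> verts G \<and> closed_nbhd G S = verts G"

text \<open>As usual for graphs given to a machine, the vertices are \<open>0, \<dots>, n - 1\<close>.\<close>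

definition graph_inputs :: "(nat graph \<times> nat) set" where
  "graph_inputs = {(G, k). simple_graph G \<and> verts G = {..<card (verts G)} \<and> k \<le> card (verts G)}"

definition Dominating_Set :: "(nat graph \<times> nat, nat set option) problem" where
  "Dominating_Set =
     search_problem graph_inputs (\<lambda>(G, k). card (verts G))
       (\<lambda>(G, k) S. dominating_set G S \<and> card S = k)"

section \<open>Binary encodings\<close>

text \<open>Since \<open>k \<le> n\<close> and the adjacency matrix has \<open>n\<^sup>2\<close> bits, writing \<open>n\<close> and \<open>k\<close> in
  unary does not affect which running times are polynomial.\<close>

definition enc_nat :: "nat \<Rightarrow> bool list" where
  "enc_nat n = replicate n True @ [False]"

definition enc_graph :: "nat graph \<Rightarrow> bool list" where
  "enc_graph G =
     (let n = card (verts G)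
      in enc_nat n @ concat (map (\<lambda>i. map (\<lambda>j. {i, j} \<in> edges G) [0..<n]) [0..<n]))"

definition enc_input :: "nat graph \<times> nat \<Rightarrow> bool list" where
  "enc_input I = enc_graph (fst I) @ enc_nat (snd I)"

text \<open>A vertex set is written as its characteristic vector, whose length is known from the graph
  preceding it.\<close>

definition enc_output :: "(nat graph \<times> nat) \<times> nat set option \<Rightarrow> bool list" where
  "enc_output = (\<lambda>(J, a). enc_input J @
     (case a of None \<Rightarrow> [False]
      | Some S \<Rightarrow> True # map (\<lambda>v. v \<in> S) [0..<card (verts (fst J))]))"

lemma enc_nat_append_eq: "enc_nat m @ xs = enc_nat n @ ys \<longleftrightarrow> m = n \<and> xs = ys"
proof (induction m arbitrary: n)
  case 0
  then show ?case by (cases n) (auto simp: enc_nat_def)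
next
  case (Suc m)
  then show ?case by (cases n) (auto simp: enc_nat_def)
qed

lemma length_matrix:
  "length (concat (map (\<lambda>i. map (f i) [0..<m]) [0..<n])) = n * m"
  by (induction n) auto

lemma matrix_eqD:
  assumes "concat (map (\<lambda>i. map (f i) [0..<m]) [0..<n]) = concat (map (\<lambda>i. map (g i) [0..<m]) [0..<n])"
    and "i < n" "j < m"
  shows "f i j = g i j"
  using assms by (induction n) (auto simp: length_matrix less_Suc_eq)

lemma enc_graph_append_eqD:
  assumes G: "simple_graph G" "verts G = {..<card (verts G)}"
    and H: "simple_graph H" "verts H = {..<card (verts H)}"
    and eq: "enc_graph G @ xs = enc_graph H @ ys"
  shows "G = H \<and> xs = ys"
proof -
  define n where "n = card (verts G)"
  have n: "card (verts H) = n"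
    and eq': "concat (map (\<lambda>i. map (\<lambda>j. {i, j} \<in> edges G) [0..<n]) [0..<n]) @ xs
      = concat (map (\<lambda>i. map (\<lambda>j. {i, j} \<in> edges H) [0..<n]) [0..<n]) @ ys"
    using eq by (auto simp: enc_graph_def enc_nat_append_eq Let_def n_def)
  have m: "concat (map (\<lambda>i. map (\<lambda>j. {i, j} \<in> edges G) [0..<n]) [0..<n])
      = concat (map (\<lambda>i. map (\<lambda>j. {i, j} \<in> edges H) [0..<n]) [0..<n])" and "xs = ys"
    using eq' by (auto simp: append_eq_append_conv length_matrix)
  have V: "verts G = {..<n}" "verts H = {..<n}"
    using G(2) H(2) n by (auto simp: n_def)
  have *: "{i, j} \<in> edges G \<longleftrightarrow> {i, j} \<in> edges H" if "i < n" "j < n" for i j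
    using matrix_eqD[OF m that] .
  have "e \<in> edges G \<longleftrightarrow> e \<in> edges H" for e
  proof (cases "e \<subseteq> {..<n} \<and> card e = 2")
    case True
    then obtain i j where "e = {i, j}" by (auto simp: card_2_iff)
    with True * show ?thesis by simp
  next
    case False
    with G(1) H(1) V show ?thesis by (auto simp: simple_graph_def)
  qed
  with V \<open>xs = ys\<close> show ?thesis by (auto intro: graph.equality)
qed

lemma enc_input_append_eqD:
  assumes "I \<in> graph_inputs" "J \<in> graph_inputs" "enc_input I @ xs = enc_input J @ ys"
  shows "I = J \<and> xs = ys"
  using assms enc_graph_append_eqD[of "fst I" "fst J" "enc_nat (snd I) @ xs" "enc_nat (snd J) @ ys"]
  by (auto simp: graph_inputs_def enc_input_def enc_nat_append_eq)

lemma inj_on_enc_input: "inj_on enc_input graph_inputs"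
  by (auto intro!: inj_onI dest: enc_input_append_eqD[where xs = "[]" and ys = "[]"])

lemma inj_on_enc_output:
  "inj_on enc_output {(J, a). J \<in> graph_inputs \<and> (\<forall>S. a = Some S \<longrightarrow> S \<subseteq> verts (fst J))}"
proof (rule inj_onI)
  fix x y
  assume xy: "x \<in> {(J, a). J \<in> graph_inputs \<and> (\<forall>S. a = Some S \<longrightarrow> S \<subseteq> verts (fst J))}"
      "y \<in> {(J, a). J \<in> graph_inputs \<and> (\<forall>S. a = Some S \<longrightarrow> S \<subseteq> verts (fst J))}"
    and eq0: "enc_output x = enc_output y"
  obtain G k a H l b where x: "x = ((G, k), a)" and y: "y = ((H, l), b)"
    by (metis surj_pair)
  have J: "(G, k) \<in> graph_inputs" "(H, l) \<in> graph_inputs"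
    and a: "\<forall>S. a = Some S \<longrightarrow> S \<subseteq> verts G"
    and b: "\<forall>S. b = Some S \<longrightarrow> S \<subseteq> verts H"
    and eq: "enc_output ((G, k), a) = enc_output ((H, l), b)"
    using xy eq0 by (auto simp: x y)
  have *: "(G, k) = (H, l)" "(case a of None \<Rightarrow> [False] | Some S \<Rightarrow> True # map (\<lambda>v. v \<in> S) [0..<card (verts G)])
      = (case b of None \<Rightarrow> [False] | Some S \<Rightarrow> True # map (\<lambda>v. v \<in> S) [0..<card (verts H)])"
    using enc_input_append_eqD[OF J eq[unfolded enc_output_def, simplified]]
    by (auto cong: option.case_cong)
  have V: "verts H = {..<card (verts H)}" using J by (auto simp: graph_inputs_def)
  have "a = b"
  proof (cases "a = None \<or> b = None")
    case True
    with * show ?thesis by (auto split: option.splits)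
  next
    case False
    then obtain S T where [simp]: "a = Some S" "b = Some T" by auto
    have "v \<in> S \<longleftrightarrow> v \<in> T" if "v < card (verts H)" for v
      using * that by auto
    moreover have "S \<subseteq> {..<card (verts H)}" "T \<subseteq> {..<card (verts H)}"
      using a b *(1) V by auto
    ultimately show ?thesis by auto
  qed
  with * show "x = y" by (simp add: x y)
qed

end

theory Submission imports Defs begin

text \<open>
  If \<open>G\<close> has a dominating set of size \<open>k > 0\<close> and \<open>U\<close> is the set of vertices not yet covered, then
  some vertex covers at least \<open>card U / k\<close> vertices of \<open>U\<close>. A greedy algorithm that only accepts such
  vertices either gets stuck, and then there is no dominating set of size \<open>k\<close>, so that \<open>G\<close> itself
  and nil are correct, or it selects \<open>k\<close> vertices and leaves at most
  \<open>n (1 - 1/k) ^ k \<le> n / e\<close> vertices uncovered. In the latter case the edges from the first selected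
  vertex to the uncovered ones are added. As acceptance is decided by the integer inequality
  \<open>card U \<le> k * card (U \<inter> nbhd v)\<close>, the algorithm never computes with \<open>e\<close>.

  A sweep tries all vertices once in order; it either selects a vertex or shows that the algorithm is
  stuck, so \<open>n\<close> sweeps are enough. Every pass of the Turing machine over a row of the adjacency
  matrix is a streaming pass with the heads on several arrays moving in parallel.
\<close>

section \<open>A structured programming language for Turing machines\<close>

text \<open>The averaging argument only promises a vertex above the share \<open>card U / k\<close>,
  so a threshold test is enough and no maximum has to be searched. Refusal is not final: as
  \<open>U\<close> shrinks the threshold drops, and a vertex refused earlier can qualify later;
  hence repeated sweeps. The answer must have exactly \<open>k\<close> elements, and the same test
  takes care of that: for empty \<open>U\<close> it reads \<open>0 \<le> 0\<close>, so unselected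
  vertices keep being accepted until \<open>k\<close> are chosen. One added edge per uncovered
  vertex makes the distance at most \<open>card U\<close>; this needs a selected vertex to attach
  to, so \<open>k = 0\<close> is separate. The machine and the greedy argument meet only in
  \<open>output_word\<close>: running the program yields this word for an arbitrary 0/1 matrix, and
  the word is then shown to encode a correct answer when the matrix comes from a graph.\<close>

definition move_head :: "move \<Rightarrow> tape \<Rightarrow> tape" where
  "move_head m t = (fst t, snd t + offset m)"

text \<open>Tests and written symbols may depend on the symbols under all heads, which allows arrays
  to be compared cell by cell, while each primitive changes one tape only, so that its effect is a
  single list update. There is no empty program; \<open>Mv i Stay\<close> serves as one.\<close>

datatype prog =
    Mv nat move
  | Wr nat "nat list \<Rightarrow> nat" move
  | Seq prog prog (infixr ";;" 60)
  | Cond "nat list \<Rightarrow> bool" prog prog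
  | Loop "nat list \<Rightarrow> bool" prog

inductive exec :: "prog \<Rightarrow> tape list \<Rightarrow> nat \<Rightarrow> tape list \<Rightarrow> bool" where
  Mv: "i < length s \<Longrightarrow> exec (Mv i m) s 1 (s[i := move_head m (s ! i)])"
| Wr: "i < length s \<Longrightarrow> exec (Wr i f m) s 1 (s[i := act (f (map read s), m) (s ! i)])"
| Seq: "exec p s t s' \<Longrightarrow> exec q s' t' s'' \<Longrightarrow> exec (p ;; q) s (t + t') s''"
| CondT: "c (map read s) \<Longrightarrow> exec p s t s' \<Longrightarrow> exec (Cond c p q) s (Suc t) s'"
| CondF: "\<not> c (map read s) \<Longrightarrow> exec q s t s' \<Longrightarrow> exec (Cond c p q) s (Suc t) s'"
| LoopT: "c (map read s) \<Longrightarrow> exec p s t s' \<Longrightarrow> exec (Loop c p) s' t' s'' \<Longrightarrow>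
    exec (Loop c p) s (Suc (t + t')) s''"
| LoopF: "\<not> c (map read s) \<Longrightarrow> exec (Loop c p) s 1 s"

primrec code_size :: "prog \<Rightarrow> nat" where
  "code_size (Mv i m) = 1"
| "code_size (Wr i f m) = 1"
| "code_size (p ;; q) = code_size p + code_size q"
| "code_size (Cond c p q) = Suc (code_size p + code_size q)"
| "code_size (Loop c p) = Suc (code_size p)"

definition stay :: "nat list \<Rightarrow> (nat \<times> move) list" where
  "stay ss = map (\<lambda>x. (x, Stay)) ss"

text \<open>The code of a program occupies the states from \<open>b\<close> to \<open>b + code_size p - 1\<close>, and control
  leaves it by a transition to the state \<open>e\<close>.\<close>

primrec code ::
  "prog \<Rightarrow> nat \<Rightarrow> nat \<Rightarrow> nat \<Rightarrow> nat list \<Rightarrow> nat \<times> (nat \<times> move) list" where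
  "code (Mv i m) b e q ss = (e, (stay ss)[i := (ss ! i, m)])"
| "code (Wr i f m) b e q ss = (e, (stay ss)[i := (f ss, m)])"
| "code (p ;; r) b e q ss =
     (if q < b + code_size p then code p b (b + code_size p) q ss
      else code r (b + code_size p) e q ss)"
| "code (Cond c p r) b e q ss =
     (if q = b then (if c ss then Suc b else Suc b + code_size p, stay ss)
      else if q < Suc b + code_size p then code p (Suc b) e q ss
      else code r (Suc b + code_size p) e q ss)"
| "code (Loop c p) b e q ss =
     (if q = b then (if c ss then Suc b else e, stay ss) else code p (Suc b) b q ss)"

lemma act_read: "act (read t, m) t = move_head m t"
  by (simp add: act_def read_def move_head_def)

lemma act_stay: "map2 act (stay (map read s)) s = s"
  by (induction s) (auto simp: stay_def act_def read_def)

lemma map2_update: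
  "map2 f (xs[i := x]) ys = (map2 f xs ys)[i := f x (ys ! i)]" if "i < length ys"
proof (cases "i < length xs")
  case True
  with that show ?thesis by (simp add: list_eq_iff_nth_eq nth_list_update)
next
  case False
  then show ?thesis by (simp add: list_update_beyond)
qed

text \<open>The exit state \<open>e\<close> is generalised because the induction redirects it: the
  first part of a sequence exits to the start of the second, and a loop body exits to its own test.
  The bound on \<open>b + code_size p\<close> keeps all states of the code below the halting state,
  so that \<open>step\<close> does fire \<open>tm_delta\<close>.\<close>

lemma exec_imp_steps:
  assumes "exec p s t s'"
    and "b + code_size p \<le> tm_states M"
    and "\<And>q ss. b \<le> q \<Longrightarrow> q < b + code_size p \<Longrightarrow> tm_delta M q ss = code p b e q ss"
  shows "(step M ^^ t) (b, s) = (e, s')"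
  using assms
proof (induction arbitrary: b e)
  case (Mv i s m)
  then show ?case
    by (simp add: map2_update act_stay act_read)
next
  case (Wr i s f m)
  then show ?case
    by (simp add: map2_update act_stay)
next
  case (Seq p s t s' q t' s'')
  have 1: "(step M ^^ t) (b, s) = (b + code_size p, s')"
    using Seq.prems by (intro Seq.IH(1)) auto
  have 2: "(step M ^^ t') (b + code_size p, s') = (e, s'')"
    using Seq.prems by (intro Seq.IH(2)) auto
  show ?case
    using 1 2 by (simp add: funpow_add add.commute[of t])
next
  case (CondT c s p t s' q)
  have "(step M ^^ t) (Suc b, s) = (e, s')"
    using CondT.prems by (intro CondT.IH) auto
  moreover have "step M (b, s) = (Suc b, s)"
    using CondT by (simp add: act_stay)
  ultimately show ?case
    by (simp add: funpow_Suc_right del: funpow.simps)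
next
  case (CondF c s q t s' p)
  have "(step M ^^ t) (Suc b + code_size p, s) = (e, s')"
    using CondF.prems by (intro CondF.IH) auto
  moreover have "step M (b, s) = (Suc b + code_size p, s)"
    using CondF by (simp add: act_stay)
  ultimately show ?case
    by (simp add: funpow_Suc_right del: funpow.simps)
next
  case (LoopT c s p t s' t' s'')
  have 1: "(step M ^^ t) (Suc b, s) = (b, s')"
    using LoopT.prems by (intro LoopT.IH(1)) auto
  have 2: "(step M ^^ t') (b, s') = (e, s'')"
    using LoopT.prems by (intro LoopT.IH(2)) auto
  have "step M (b, s) = (Suc b, s)"
    using LoopT by (simp add: act_stay)
  then have "(step M ^^ Suc (t' + t)) (b, s) = (e, s'')"
    using 1 2 by (simp add: funpow_Suc_right funpow_add del: funpow.simps)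
  then show ?case by (simp add: add.commute)
next
  case (LoopF c s p)
  then show ?case by (simp add: act_stay)
qed

primrec wf_prog :: "nat \<Rightarrow> nat \<Rightarrow> prog \<Rightarrow> bool" where
  "wf_prog k N (Mv i m) \<longleftrightarrow> i < k"
| "wf_prog k N (Wr i f m) \<longleftrightarrow>
     i < k \<and> (\<forall>ss. length ss = k \<and> set ss \<subseteq> {..<N} \<longrightarrow> f ss < N)"
| "wf_prog k N (p ;; q) \<longleftrightarrow> wf_prog k N p \<and> wf_prog k N q"
| "wf_prog k N (Cond c p q) \<longleftrightarrow> wf_prog k N p \<and> wf_prog k N q"
| "wf_prog k N (Loop c p) \<longleftrightarrow> wf_prog k N p"

definition compile :: "nat \<Rightarrow> nat \<Rightarrow> prog \<Rightarrow> tm" where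
  "compile k N p = \<lparr> tm_tapes = k, tm_symbols = N, tm_states = code_size p,
     tm_delta = code p 0 (code_size p) \<rparr>"

lemma stay_update_symbols:
  assumes "set ss \<subseteq> {..<N}" "x < N"
  shows "fst ` set ((stay ss)[i := (x, m)]) \<subseteq> {..<N}"
proof -
  have "set ((stay ss)[i := (x, m)]) \<subseteq> insert (x, m) (set (stay ss))"
    by (rule set_update_subset_insert)
  then show ?thesis using assms by (fastforce simp: stay_def)
qed

lemma wf_code:
  assumes "wf_prog k N p" "length ss = k" "set ss \<subseteq> {..<N}"
    and "b \<le> q" "q < b + code_size p" "b + code_size p \<le> Q" "e \<le> Q"
  shows "fst (code p b e q ss) \<le> Q \<and> length (snd (code p b e q ss)) = k \<and>
    fst ` set (snd (code p b e q ss)) \<subseteq> {..<N}"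
  using assms
proof (induction p arbitrary: b e)
  case (Mv i m)
  have "ss ! i \<in> set ss" using Mv by simp
  then have "ss ! i < N" using Mv by blast
  with Mv show ?case using stay_update_symbols[of ss N "ss ! i" i m] by (simp add: stay_def)
next
  case (Wr i f m)
  then have "f ss < N" by auto
  with Wr show ?case using stay_update_symbols[of ss N "f ss" i m] by (simp add: stay_def)
next
  case (Seq p1 p2)
  show ?case
  proof (cases "q < b + code_size p1")
    case True
    then show ?thesis using Seq.prems Seq.IH(1)[of b "b + code_size p1"] by simp
  next
    case False
    then show ?thesis using Seq.prems Seq.IH(2)[of "b + code_size p1" e] by simp
  qed
next
  case (Cond c p1 p2)
  have "fst ` set (stay ss) = set ss" by (force simp: stay_def)
  then show ?case using Cond.prems Cond.IH(1)[of "Suc b" e] Cond.IH(2)[of "Suc b + code_size p1" e]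
    by (auto simp: stay_def)
next
  case (Loop c p)
  have "fst ` set (stay ss) = set ss" by (force simp: stay_def)
  then show ?case using Loop.prems Loop.IH[of "Suc b" b]
    by (auto simp: stay_def)
qed

lemma wf_compile:
  assumes "wf_prog k N p" "k \<ge> 1" "N \<ge> 3"
  shows "wf_tm (compile k N p)"
  using assms wf_code[OF assms(1), of _ 0 _ "code_size p" "code_size p"]
  by (auto simp: wf_tm_def compile_def case_prod_unfold)

lemma step_halt: "(step M ^^ t) (tm_states M, s) = (tm_states M, s)"
  by (induction t) auto

lemma outputs_within_mono:
  assumes "outputs_within M x t y" "t \<le> t'"
  shows "outputs_within M x t' y"
proof -
  obtain s where s: "(step M ^^ t) (init_config M x) = (tm_states M, s)" "tape_holds (last s) y"
    using assms(1) by (auto simp: outputs_within_def split: prod.splits)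
  have "(step M ^^ (t' - t + t)) (init_config M x) = (tm_states M, s)"
    by (simp only: funpow_add comp_apply s step_halt)
  with assms(2) s show ?thesis by (simp add: outputs_within_def)
qed

text \<open>\<open>exec\<close> counts steps exactly, as the simulation needs; an upper bound lets
  branches and iterations of different lengths share one time.\<close>

definition run :: "prog \<Rightarrow> tape list \<Rightarrow> nat \<Rightarrow> tape list \<Rightarrow> bool" where
  "run p s t s' \<longleftrightarrow> (\<exists>u\<le>t. exec p s u s')"

lemma run_imp_outputs_within:
  assumes "run p (input_tape x # replicate (k - 1) (input_tape [])) t s'"
    and "tape_holds (last s') y"
  shows "outputs_within (compile k N p) x t y"
proof -
  let ?M = "compile k N p"
  obtain u where u: "u \<le> t" "exec p (input_tape x # replicate (k - 1) (input_tape [])) u s'"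
    using assms by (auto simp: run_def)
  have "(step ?M ^^ u) (init_config ?M x) = (tm_states ?M, s')"
    using exec_imp_steps[OF u(2), of 0 ?M "code_size p"] by (simp add: init_config_def compile_def)
  with assms have "outputs_within ?M x u y" by (simp add: outputs_within_def)
  from outputs_within_mono[OF this u(1)] show ?thesis .
qed

lemma run_Mv: "i < length s \<Longrightarrow> run (Mv i m) s 1 (s[i := move_head m (s ! i)])"
  unfolding run_def using exec.Mv by blast

lemma run_Wr: "i < length s \<Longrightarrow> run (Wr i f m) s 1 (s[i := act (f (map read s), m) (s ! i)])"
  unfolding run_def using exec.Wr by blast

lemma run_Seq: "run p s t s' \<Longrightarrow> run q s' t' s'' \<Longrightarrow> run (p ;; q) s (t + t') s''"
  unfolding run_def by (meson add_mono exec.Seq)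

lemma run_CondT: "c (map read s) \<Longrightarrow> run p s t s' \<Longrightarrow> run (Cond c p q) s (Suc t) s'"
  unfolding run_def by (meson Suc_le_mono exec.CondT)

lemma run_CondF: "\<not> c (map read s) \<Longrightarrow> run q s t s' \<Longrightarrow> run (Cond c p q) s (Suc t) s'"
  unfolding run_def by (meson Suc_le_mono exec.CondF)

lemma run_mono: "run p s t s' \<Longrightarrow> t \<le> t' \<Longrightarrow> run p s t' s'"
  unfolding run_def by (meson order_trans)

text \<open>The family \<open>S\<close> plays the part of a loop invariant: it fixes the tapes after
  each iteration. Each iteration costs one step for the test, and the last test, which fails, gives
  the final \<open>+ 1\<close>.\<close>

lemma run_Loop:
  assumes "\<And>i. i < m \<Longrightarrow> c (map read (S i))"
    and "\<And>i. i < m \<Longrightarrow> run p (S i) t (S (Suc i))"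
    and "\<not> c (map read (S m))" and "s = S 0" and "s' = S m"
  shows "run (Loop c p) s (m * Suc t + 1) s'"
proof -
  \<comment> \<open>The induction counts the iterations still to come, since
    \<open>exec.LoopT\<close> prepends one.\<close>
  have "run (Loop c p) (S (m - i)) (i * Suc t + 1) (S m)" if "i \<le> m" for i
    using that
  proof (induction i)
    case 0
    have "exec (Loop c p) (S m) 1 (S m)" using assms(3) by (rule exec.LoopF)
    then show ?case by (auto simp: run_def)
  next
    case (Suc i)
    then obtain u where u: "u \<le> i * Suc t + 1" "exec (Loop c p) (S (m - i)) u (S m)"
      by (auto simp: run_def)
    have "m - i = Suc (m - Suc i)" using Suc.prems by simp
    with assms(2)[of "m - Suc i"] Suc.prems obtain u' where
      u': "u' \<le> t" "exec p (S (m - Suc i)) u' (S (m - i))"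
      by (auto simp: run_def)
    have "exec (Loop c p) (S (m - Suc i)) (Suc (u' + u)) (S m)"
      using u u' assms(1)[of "m - Suc i"] Suc.prems by (auto intro: exec.LoopT)
    moreover have "Suc (u' + u) \<le> Suc i * Suc t + 1" using u u' by simp
    ultimately show ?case unfolding run_def by blast
  qed
  from this[of m] assms(4,5) show ?thesis by simp
qed

subsection \<open>Loop-free programs\<close>

primrec loop_free :: "nat \<Rightarrow> prog \<Rightarrow> bool" where
  "loop_free k (Mv i m) \<longleftrightarrow> i < k"
| "loop_free k (Wr i f m) \<longleftrightarrow> i < k"
| "loop_free k (p ;; q) \<longleftrightarrow> loop_free k p \<and> loop_free k q"
| "loop_free k (Cond c p q) \<longleftrightarrow> loop_free k p \<and> loop_free k q"
| "loop_free k (Loop c p) \<longleftrightarrow> False"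

primrec eval_prog :: "prog \<Rightarrow> tape list \<Rightarrow> tape list" where
  "eval_prog (Mv i m) s = s[i := move_head m (s ! i)]"
| "eval_prog (Wr i f m) s = s[i := act (f (map read s), m) (s ! i)]"
| "eval_prog (p ;; q) s = eval_prog q (eval_prog p s)"
| "eval_prog (Cond c p q) s = (if c (map read s) then eval_prog p s else eval_prog q s)"
| "eval_prog (Loop c p) s = s"

text \<open>Without loops each state of the code is visited at most once, so
  \<open>code_size\<close> bounds the time and the simplifier can compute the result by
  \<open>eval_prog\<close>.\<close>

lemma run_loop_free:
  assumes "loop_free (length s) p" "code_size p \<le> t" "eval_prog p s = s'"
  shows "run p s t s'"
proof -
  have "length (eval_prog p s) = length s \<and> run p s (code_size p) (eval_prog p s)"
    if "loop_free (length s) p" for p s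
    using that
  proof (induction p arbitrary: s)
    case (Seq p q)
    then show ?case by (metis run_Seq eval_prog.simps(3) code_size.simps(3) loop_free.simps(3))
  next
    case (Cond c p q)
    show ?case
    proof (cases "c (map read s)")
      case True
      with Cond have "run (Cond c p q) s (Suc (code_size p)) (eval_prog p s)"
        by (intro run_CondT) auto
      with Cond True show ?thesis by (auto intro: run_mono)
    next
      case False
      with Cond have "run (Cond c p q) s (Suc (code_size q)) (eval_prog q s)"
        by (intro run_CondF) auto
      with Cond False show ?thesis by (auto intro: run_mono)
    qed
  qed (use run_Mv run_Wr in auto)
  with assms show ?thesis by (blast intro: run_mono)
qed

section \<open>Arrays and stacks on tapes\<close>

text \<open>The cells on both sides are blank, so a head notices either end of the array by reading
  0; head positions \<open>-1\<close> and \<open>n\<close> do occur. This is why the stored symbols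
  are kept nonzero.\<close>

definition arr :: "nat \<Rightarrow> (nat \<Rightarrow> nat) \<Rightarrow> int \<Rightarrow> tape" where
  "arr n f p = ((\<lambda>i. if 0 \<le> i \<and> i < int n then f (nat i) else 0), p)"

lemma read_arr [simp]: "read (arr n f p) = (if 0 \<le> p \<and> p < int n then f (nat p) else 0)"
  by (simp add: arr_def read_def)

lemma move_head_arr [simp]: "move_head m (arr n f p) = arr n f (p + offset m)"
  by (simp add: arr_def move_head_def)

lemma act_arr: "0 \<le> p \<Longrightarrow> p < int n \<Longrightarrow> act (x, m) (arr n f p) = arr n (f(nat p := x)) (p + offset m)"
  by (auto simp: arr_def act_def fun_eq_iff)

lemma act_arr_append:
  "act (x, m) (arr n f (int n)) = arr (Suc n) (f(n := x)) (int n + offset m)"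
  by (auto simp: arr_def act_def fun_eq_iff)

lemma arr_cong: "(\<And>i. i < n \<Longrightarrow> f i = g i) \<Longrightarrow> p = q \<Longrightarrow> arr n f p = arr n g q"
  by (auto simp: arr_def fun_eq_iff)

lemma act_arr_append_const [simp]:
  "act (c, m) (arr n (\<lambda>_. c) (int n)) = arr (Suc n) (\<lambda>_. c) (int n + offset m)"
  unfolding act_arr_append by (rule arr_cong) auto

text \<open>The head is on the top element, and on the blank cell \<open>-1\<close> when the stack
  is empty, so emptiness is a test of the symbol under the head.\<close>

abbreviation stack :: "nat \<Rightarrow> tape" where
  "stack h \<equiv> arr h (\<lambda>_. 1) (int h - 1)"

lemma pop_stack: "act (0, Lft) (stack (Suc h)) = stack h"
  by (auto simp: arr_def act_def fun_eq_iff)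

definition output_tape :: "bool list \<Rightarrow> tape" where
  "output_tape ys = (fst (input_tape ys), int (length ys))"

lemma act_output_tape:
  "act (bit_symbol b, Rgt) (output_tape ys) = output_tape (ys @ [b])"
  by (auto simp: output_tape_def input_tape_def act_def fun_eq_iff nth_append)

lemma tape_holds_output_tape: "tape_holds (output_tape ys) ys"
  by (simp add: output_tape_def input_tape_def tape_holds_def)

section \<open>The program\<close>

text \<open>
  Tapes: 0 holds the input and is never written; 1 and 2 hold arrays indexed by the vertices, with
  the selected vertices (3 for the first one, 4 for the others, 1 for unselected vertices) and the
  uncovered vertices (2 for uncovered, 1 for covered); 3 contains a single mark at cell 0, and its
  head is at \<open>j - v\<close> when vertex \<open>j\<close> is looked at in row \<open>v\<close>; 4 is a stack used as a
  counter; 5 holds \<open>k\<close> in unary; 6 holds the symbols with which the successive selected vertices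
  are marked, and its head is at the number of selected vertices; 7 counts the sweeps; 8 is the
  output.
\<close>

definition nonblank :: "nat \<Rightarrow> nat list \<Rightarrow> bool" where
  "nonblank i ss \<longleftrightarrow> ss ! i \<noteq> 0"

definition on_one :: "nat list \<Rightarrow> bool" where
  "on_one ss \<longleftrightarrow> ss ! 0 = 2"

definition in_nbhd :: "nat list \<Rightarrow> bool" where
  "in_nbhd ss \<longleftrightarrow> ss ! 0 = 2 \<or> ss ! 3 = 1"

text \<open>The initial left move leaves the blank just past the end, where passes stop; the final
  right move returns from the blank cell \<open>-1\<close>.\<close>

definition rewind :: "nat \<Rightarrow> prog" where
  "rewind i = Mv i Lft ;; Loop (nonblank i) (Mv i Lft) ;; Mv i Rgt"

definition to_matrix :: prog where
  "to_matrix = rewind 0 ;; Loop on_one (Mv 0 Rgt) ;; Mv 0 Rgt"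

definition write_arrays :: prog where
  "write_arrays =
     Loop on_one (Wr 1 (\<lambda>_. 1) Rgt ;; Wr 2 (\<lambda>_. 2) Rgt ;; Wr 7 (\<lambda>_. 1) Rgt ;; Mv 0 Rgt)"

definition skip_matrix :: prog where
  "skip_matrix =
     Loop (nonblank 1) (Loop (nonblank 2) (Mv 2 Rgt ;; Mv 0 Rgt) ;; rewind 2 ;; Mv 1 Rgt)"

definition write_counters :: prog where
  "write_counters = Loop on_one (Wr 5 (\<lambda>_. 1) Rgt ;; Wr 6 (\<lambda>_. 4) Rgt ;; Mv 0 Rgt)"

text \<open>After \<open>write_counters\<close> the cells of tape 6 hold 4; the first one is changed
  to 3, unless \<open>k = 0\<close> left none. Moving head 4 left turns a blank tape into the empty
  stack.\<close>

definition initialize :: prog where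
  "initialize = write_arrays ;; Mv 0 Rgt ;; rewind 1 ;; rewind 2 ;; rewind 7 ;;
     skip_matrix ;; rewind 1 ;; write_counters ;; rewind 5 ;; rewind 6 ;;
     (Wr 6 (\<lambda>ss. if ss ! 6 = 0 then 0 else 3) Stay ;; Wr 3 (\<lambda>_. 1) Stay ;; Mv 4 Lft) ;;
     to_matrix"

definition push_uncovered :: prog where
  "push_uncovered = Loop (nonblank 2)
     (Cond (\<lambda>ss. ss ! 2 = 2) (Mv 4 Rgt ;; Wr 4 (\<lambda>_. 1) Stay) (Mv 4 Stay) ;; Mv 2 Rgt)"

definition pop_k :: prog where
  "pop_k = Loop (nonblank 5) (Cond (nonblank 4) (Wr 4 (\<lambda>_. 0) Lft) (Mv 4 Stay) ;; Mv 5 Rgt) ;;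
     rewind 5"

text \<open>The product \<open>k * card (U \<inter> nbhd v)\<close> is never formed: starting from
  \<open>card U\<close> marks, \<open>k\<close> are removed for each vertex that would become
  covered, and the acceptance inequality holds if and only if the stack ends up empty.\<close>

definition pop_gain :: prog where
  "pop_gain = Loop (nonblank 2)
     (Cond (\<lambda>ss. ss ! 2 = 2 \<and> in_nbhd ss) pop_k (Mv 4 Stay) ;; Mv 2 Rgt ;; Mv 0 Rgt ;; Mv 3 Rgt)"

definition row_back :: prog where
  "row_back = (Mv 2 Lft ;; Mv 0 Lft ;; Mv 3 Lft) ;;
     Loop (nonblank 2) (Mv 2 Lft ;; Mv 0 Lft ;; Mv 3 Lft) ;; (Mv 2 Rgt ;; Mv 0 Rgt ;; Mv 3 Rgt)"

definition cover :: prog where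
  "cover = Loop (nonblank 2)
     (Wr 2 (\<lambda>ss. if in_nbhd ss then 1 else ss ! 2) Rgt ;; Mv 0 Rgt ;; Mv 3 Rgt)"

definition row_forward :: prog where
  "row_forward = Loop (nonblank 2) (Mv 2 Rgt ;; Mv 0 Rgt ;; Mv 3 Rgt)"

definition clear_stack :: prog where
  "clear_stack = Loop (nonblank 4) (Wr 4 (\<lambda>_. 0) Lft)"

definition next_row :: prog where
  "next_row = (Mv 2 Lft ;; Mv 3 Lft) ;; Loop (nonblank 2) (Mv 2 Lft ;; Mv 3 Lft) ;;
     (Mv 2 Rgt ;; Mv 1 Rgt)"

text \<open>Whether the vertex is accepted is known only at the end of the row, so the heads go back
  before the row is read again for covering. \<open>row_forward\<close> makes the moves of
  \<open>cover\<close> without writing, so both branches end at the same head positions.\<close>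

definition process_row :: prog where
  "process_row = push_uncovered ;; rewind 2 ;; pop_gain ;; row_back ;;
     Cond (\<lambda>ss. ss ! 4 = 0 \<and> ss ! 1 = 1 \<and> ss ! 6 \<noteq> 0)
       ((Wr 1 (\<lambda>ss. ss ! 6) Stay ;; Mv 6 Rgt) ;; cover) row_forward ;;
     clear_stack ;; next_row"

definition sweep_rows :: prog where
  "sweep_rows = Loop (nonblank 1) process_row ;; rewind 1 ;; to_matrix ;;
     Loop (\<lambda>ss. ss ! 3 = 0) (Mv 3 Rgt)"

definition sweeps :: prog where
  "sweeps = Loop (nonblank 7) (sweep_rows ;; Mv 7 Rgt)"

text \<open>Head 6 reads a blank when \<open>k\<close> vertices are selected. Heads 5 and 1 are at
  cell 0, so the rest says \<open>k > 0\<close> or \<open>n = 0\<close>.\<close>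

definition success :: "nat list \<Rightarrow> bool" where
  "success ss \<longleftrightarrow> ss ! 6 = 0 \<and> (ss ! 5 \<noteq> 0 \<or> ss ! 1 = 0)"

text \<open>While the matrix is written, head 1 marks the row and head 2 the column, so each of the
  two tapes needs the joint symbols of all vertices. In the successful branch tape 1 is copied from
  the cell of tape 2 just written.\<close>

definition merge_arrays :: prog where
  "merge_arrays =
     Cond success
       (Loop (nonblank 1)
         (Wr 2 (\<lambda>ss. if ss ! 1 = 1 then ss ! 2 else ss ! 1) Stay ;; Wr 1 (\<lambda>ss. ss ! 2) Rgt ;; Mv 2 Rgt))
       (Loop (nonblank 1) (Wr 2 (\<lambda>_. 1) Rgt ;; Wr 1 (\<lambda>_. 1) Rgt)) ;;
     rewind 1 ;; rewind 2"

definition copy_ones :: prog where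
  "copy_ones = Loop on_one (Wr 8 (\<lambda>_. 2) Rgt ;; Mv 0 Rgt) ;; (Wr 8 (\<lambda>_. 1) Rgt ;; Mv 0 Rgt)"

definition edge_bit :: "nat list \<Rightarrow> nat" where
  "edge_bit ss = (if ss ! 0 = 2 \<or> ss ! 1 = 2 \<and> ss ! 2 = 3 \<or> ss ! 1 = 3 \<and> ss ! 2 = 2 then 2 else 1)"

definition write_matrix :: prog where
  "write_matrix = Loop (nonblank 1)
     (Loop (nonblank 2) (Wr 8 edge_bit Rgt ;; Mv 0 Rgt ;; Mv 2 Rgt) ;; rewind 2 ;; Mv 1 Rgt)"

definition write_solution :: prog where
  "write_solution = Cond success
     (Wr 8 (\<lambda>_. 2) Rgt ;;
      Loop (nonblank 1) (Wr 8 (\<lambda>ss. if ss ! 1 = 3 \<or> ss ! 1 = 4 then 2 else 1) Rgt ;; Mv 1 Rgt))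
     (Wr 8 (\<lambda>_. 1) Rgt)"

definition domination_prog :: prog where
  "domination_prog = initialize ;; sweeps ;; merge_arrays ;; rewind 0 ;; copy_ones ;;
     write_matrix ;; rewind 1 ;; copy_ones ;; write_solution"

lemmas reads_defs = nonblank_def on_one_def in_nbhd_def success_def edge_bit_def

lemma wf_domination_prog: "wf_prog 9 5 domination_prog"
proof -
  have nth: "ss ! i < 5" if "length ss = 9" "set ss \<subseteq> {..<5::nat}" "i < 9" for ss i
  proof -
    have "ss ! i \<in> set ss" using that by simp
    with that show ?thesis by blast
  qed
  show ?thesis
    by (simp add: domination_prog_def initialize_def sweeps_def merge_arrays_def copy_ones_def
        write_matrix_def write_solution_def rewind_def write_arrays_def skip_matrix_def
        write_counters_def to_matrix_def sweep_rows_def process_row_def push_uncovered_def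
        pop_gain_def pop_k_def row_back_def cover_def row_forward_def clear_stack_def next_row_def
        edge_bit_def nth)
qed

section \<open>Effect and running time of the single passes\<close>

lemma run_rewind:
  assumes "i < length s" "s ! i = arr n f p" "0 \<le> p" "p \<le> int n" "\<And>j. j < n \<Longrightarrow> f j \<noteq> 0"
  shows "run (rewind i) s (2 * n + 3) (s[i := arr n f 0])"
proof -
  obtain m where m: "p = int m" "m \<le> n" using assms by (metis zero_le_imp_eq_int of_nat_le_iff)
  have 1: "run (Mv i Lft) s 1 (s[i := arr n f (p - 1)])"
    using run_Mv[of i s Lft] assms by simp
  have 2: "run (Loop (nonblank i) (Mv i Lft)) (s[i := arr n f (p - 1)]) (m * Suc 1 + 1)
      (s[i := arr n f (- 1)])"
    by (rule run_Loop[where S = "\<lambda>j. s[i := arr n f (int m - 1 - int j)]"])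
      (use assms m in \<open>auto simp: nonblank_def intro!: run_loop_free\<close>)
  have 3: "run (Mv i Rgt) (s[i := arr n f (- 1)]) 1 (s[i := arr n f 0])"
    using run_Mv[of i "s[i := arr n f (- 1)]" Rgt] assms by simp
  show ?thesis
    unfolding rewind_def by (rule run_mono[OF run_Seq[OF 1 run_Seq[OF 2 3]]]) (use m in simp)
qed

lemma card_Int_lessThan_Suc:
  "card (A \<inter> {..<Suc j}) = card (A \<inter> {..<j}) + (if j \<in> A then 1 else 0)"
  by (simp add: lessThan_Suc Int_insert_right)

abbreviation mark :: "int \<Rightarrow> tape" where
  "mark \<equiv> arr 1 (\<lambda>_. 1)"

abbreviation unary :: "nat \<Rightarrow> int \<Rightarrow> tape" where
  "unary n \<equiv> arr n (\<lambda>_. 1)"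

definition selection_symbol :: "nat \<Rightarrow> nat" where
  "selection_symbol i = (if i = 0 then 3 else 4)"

definition flags :: "nat set \<Rightarrow> nat \<Rightarrow> nat" where
  "flags U i = (if i \<in> U then 2 else 1)"

lemma flags_simps [simp]: "flags U i \<noteq> 0" "0 < flags U i" "flags U i = 2 \<longleftrightarrow> i \<in> U" "flags U i = Suc 0 \<longleftrightarrow> i \<notin> U"
  by (auto simp: flags_def)

lemma run_push_uncovered:
  "run push_uncovered [t, v, arr n (flags U) 0, p, stack 0, a, b, c, d] (n * 6 + 1)
     [t, v, arr n (flags U) (int n), p, stack (card (U \<inter> {..<n})), a, b, c, d]"
  unfolding push_uncovered_def
  by (rule run_mono, rule run_Loop[where m = n and t = 5 and
        S = "\<lambda>j. [t, v, arr n (flags U) (int j), p, stack (card (U \<inter> {..<j})), a, b, c, d]"])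
    (auto intro!: run_loop_free arr_cong simp: reads_defs card_Int_lessThan_Suc)

lemma run_pop_k:
  "run pop_k [t, v, w, p, stack h, unary k 0, b, c, d] (7 * k + 4)
     [t, v, w, p, stack (h - k), unary k 0, b, c, d]"
proof -
  have act: "act (0, Lft) (arr (h - i) (\<lambda>_. Suc 0) (int h - int i - 1)) =
      arr (h - Suc i) (\<lambda>_. Suc 0) (int h - int i - 2)" if "i < h" for i
    using pop_stack[of "h - Suc i"] that by (simp add: Suc_diff_Suc of_nat_diff)
  have 1: "run (Loop (nonblank 5) (Cond (nonblank 4) (Wr 4 (\<lambda>_. 0) Lft) (Mv 4 Stay) ;; Mv 5 Rgt))
      [t, v, w, p, stack h, unary k 0, b, c, d] (k * 5 + 1)
      [t, v, w, p, stack (h - k), unary k (int k), b, c, d]"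
    by (rule run_mono, rule run_Loop[where m = k and t = 4 and
          S = "\<lambda>j. [t, v, w, p, stack (h - j), unary k (int j), b, c, d]"])
      (auto intro!: run_loop_free arr_cong simp: reads_defs act)
  have 2: "run (rewind 5) [t, v, w, p, stack (h - k), unary k (int k), b, c, d] (2 * k + 3)
      [t, v, w, p, stack (h - k), unary k 0, b, c, d]"
    using run_rewind[of 5 "[t, v, w, p, stack (h - k), unary k (int k), b, c, d]" k "\<lambda>_. 1" "int k"]
    by simp
  show ?thesis unfolding pop_k_def by (rule run_mono[OF run_Seq[OF 1 2]]) simp
qed

lemma run_clear_stack:
  "run clear_stack [t, v, w, p, stack h, a, b, c, d] (h * 2 + 1) [t, v, w, p, stack 0, a, b, c, d]"
proof -
  have act: "act (0, Lft) (arr (h - i) (\<lambda>_. Suc 0) (int h - int i - 1)) =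
      arr (h - Suc i) (\<lambda>_. Suc 0) (int h - int i - 2)" if "i < h" for i
    using pop_stack[of "h - Suc i"] that by (simp add: Suc_diff_Suc of_nat_diff)
  show ?thesis
    unfolding clear_stack_def
    by (rule run_mono, rule run_Loop[where m = h and t = 1 and
          S = "\<lambda>j. [t, v, w, p, stack (h - j), a, b, c, d]"])
      (auto intro!: run_loop_free arr_cong simp: reads_defs act)
qed

lemma run_next_row:
  assumes "\<And>j. j < n \<Longrightarrow> f j \<noteq> 0"
  shows "run next_row [t, arr n g x, arr n f (int n), mark p, s, a, b, c, d] (n * 3 + 5)
     [t, arr n g (x + 1), arr n f 0, mark (p - int n - 1), s, a, b, c, d]"
proof -
  have 1: "run (Mv 2 Lft ;; Mv 3 Lft) [t, arr n g x, arr n f (int n), mark p, s, a, b, c, d] 2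
      [t, arr n g x, arr n f (int n - 1), mark (p - 1), s, a, b, c, d]"
    by (rule run_loop_free) auto
  have 2: "run (Loop (nonblank 2) (Mv 2 Lft ;; Mv 3 Lft))
      [t, arr n g x, arr n f (int n - 1), mark (p - 1), s, a, b, c, d] (n * Suc 2 + 1)
      [t, arr n g x, arr n f (- 1), mark (p - int n - 1), s, a, b, c, d]"
    by (rule run_Loop[where S = "\<lambda>j. [t, arr n g x, arr n f (int n - 1 - int j),
            mark (p - 1 - int j), s, a, b, c, d]"])
      (use assms in \<open>auto intro!: run_loop_free simp: reads_defs algebra_simps\<close>)
  have 3: "run (Mv 2 Rgt ;; Mv 1 Rgt) [t, arr n g x, arr n f (- 1), mark (p - int n - 1), s, a, b, c, d] 2
      [t, arr n g (x + 1), arr n f 0, mark (p - int n - 1), s, a, b, c, d]"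
    by (rule run_loop_free) auto
  show ?thesis unfolding next_row_def
    by (rule run_mono[OF run_Seq[OF 1 run_Seq[OF 2 3]]]) simp
qed

lemma bit_symbol_eq [simp]:
  "bit_symbol b \<noteq> 0" "bit_symbol b = 2 \<longleftrightarrow> b" "bit_symbol b = Suc 0 \<longleftrightarrow> \<not> b"
  by (auto simp: bit_symbol_def)

text \<open>An arbitrary Boolean matrix stands for the graph, so that the machine is analysed apart
  from graphs as sets of two-element sets.\<close>

locale instance_tape =
  fixes n k :: nat and adj :: "nat \<Rightarrow> nat \<Rightarrow> bool"
begin

definition input_word :: "bool list" where
  "input_word = replicate n True @ [False] @ concat (map (\<lambda>i. map (adj i) [0..<n]) [0..<n])
     @ replicate k True @ [False]"

definition input_at :: "int \<Rightarrow> tape" where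
  "input_at p = arr (length input_word) (\<lambda>i. bit_symbol (input_word ! i)) p"

text \<open>The position of the first entry of row \<open>v\<close> of the adjacency matrix, and for \<open>v = n\<close> that of
  the unary \<open>k\<close>.\<close>

definition row_pos :: "nat \<Rightarrow> int" where
  "row_pos v = int n + 1 + int v * int n"

lemma length_input_word: "length input_word = n + 1 + n * n + k + 1"
  by (simp add: input_word_def length_matrix)

lemma input_at_0: "input_at 0 = input_tape input_word"
  by (auto simp: input_at_def input_tape_def arr_def)

lemma move_head_input_at [simp]: "move_head m (input_at p) = input_at (p + offset m)"
  by (simp add: input_at_def)

lemma read_input_at:
  "j < length input_word \<Longrightarrow> read (input_at (int j)) = bit_symbol (input_word ! j)"
  by (simp add: input_at_def)

lemma read_input_at_size: "read (input_at (int j)) = 2 \<longleftrightarrow> j < n" if "j \<le> n"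
proof -
  have "input_word ! j \<longleftrightarrow> j < n"
    using that by (auto simp: input_word_def nth_append)
  then show ?thesis
    using that by (subst read_input_at) (auto simp: length_input_word)
qed

lemma nth_matrix:
  "i < m \<Longrightarrow> j < l \<Longrightarrow> concat (map (\<lambda>i. map (f i) [0..<l]) [0..<m]) ! (i * l + j) = f i j"
proof (induction m)
  case (Suc m)
  show ?case
  proof (cases "i < m")
    case True
    have "i * l + j < Suc i * l" using Suc.prems by simp
    also have "\<dots> \<le> m * l" using True by (intro mult_le_mono1) simp
    finally show ?thesis using Suc True by (simp add: nth_append length_matrix)
  next
    case False
    with Suc.prems have "i = m" by simp
    with Suc.prems show ?thesis by (simp add: nth_append length_matrix)
  qed
qed simp

lemma read_input_at_matrix:
  assumes "v < n" "j < n"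
  shows "read (input_at (row_pos v + int j)) = bit_symbol (adj v j)"
proof -
  have "v * n + j < Suc v * n" using assms by simp
  also have "\<dots> \<le> n * n" using assms by (intro mult_le_mono1) simp
  finally have *: "v * n + j < n * n" .
  have "row_pos v + int j = int (n + 1 + (v * n + j))" by (simp add: row_pos_def)
  moreover have "input_word ! (n + 1 + (v * n + j)) = adj v j"
    using * assms by (simp add: input_word_def nth_append length_matrix nth_matrix)
  moreover have "n + 1 + (v * n + j) < length input_word"
    using * by (simp add: length_input_word)
  ultimately show ?thesis using read_input_at by presburger
qed

lemma read_input_at_param:
  assumes "j \<le> k"
  shows "read (input_at (row_pos n + int j)) = 2 \<longleftrightarrow> j < k"
proof -
  have "row_pos n + int j = int (n + 1 + n * n + j)" by (simp add: row_pos_def)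
  moreover have "input_word ! (n + 1 + n * n + j) \<longleftrightarrow> j < k"
    using assms by (auto simp: input_word_def nth_append length_matrix)
  moreover have "n + 1 + n * n + j < length input_word"
    using assms by (simp add: length_input_word)
  ultimately show ?thesis using read_input_at by (metis bit_symbol_eq(2))
qed

definition nbhd :: "nat \<Rightarrow> nat set" where
  "nbhd v = {u. u < n \<and> (adj v u \<or> u = v)}"

lemma in_nbhd_iff:
  assumes "v < n" "j < n"
  shows "(read (input_at (row_pos v + int j)) = 2 \<or> read (mark (int j - int v)) = 1) \<longleftrightarrow> j \<in> nbhd v"
  using assms by (auto simp: read_input_at_matrix nbhd_def)

lemma run_pop_gain:
  assumes "v < n" "U \<subseteq> {..<n}"
  shows "run pop_gain
     [input_at (row_pos v), x, arr n (flags U) 0, mark (- int v), stack h, unary k 0, b, c, d]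
     (n * (7 * k + 9) + 1)
     [input_at (row_pos (Suc v)), x, arr n (flags U) (int n), mark (int n - int v),
      stack (h - k * card (U \<inter> nbhd v)), unary k 0, b, c, d]"
proof -
  let ?S = "\<lambda>j. [input_at (row_pos v + int j), x, arr n (flags U) (int j), mark (int j - int v),
      stack (h - k * card ((U \<inter> nbhd v) \<inter> {..<j})), unary k 0, b, c, d]"
  have "run (Loop (nonblank 2)
     (Cond (\<lambda>ss. ss ! 2 = 2 \<and> in_nbhd ss) pop_k (Mv 4 Stay) ;; Mv 2 Rgt ;; Mv 0 Rgt ;; Mv 3 Rgt))
     (?S 0) (n * Suc (7 * k + 8) + 1) (?S n)"
  proof (rule run_Loop[where S = ?S])
    fix j assume j: "j < n"
    let ?c = "\<lambda>ss. ss ! 2 = 2 \<and> in_nbhd ss"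
    let ?s = "[input_at (row_pos v + int j), x, arr n (flags U) (int j), mark (int j - int v),
      stack (h - k * card ((U \<inter> nbhd v) \<inter> {..<Suc j})), unary k 0, b, c, d]"
    have c: "?c (map read (?S j)) \<longleftrightarrow> j \<in> U \<inter> nbhd v"
      using j in_nbhd_iff[OF assms(1) j] by (simp add: in_nbhd_def)
    have 1: "run (Cond ?c pop_k (Mv 4 Stay)) (?S j) (Suc (7 * k + 4)) ?s"
    proof (cases "j \<in> U \<inter> nbhd v")
      case True
      \<comment> \<open>Truncated subtraction still splits this way, in agreement with
        \<open>pop_k\<close>, which stops at the empty stack.\<close>
      then have eq: "h - k * card ((U \<inter> nbhd v) \<inter> {..<Suc j}) = h - k * card ((U \<inter> nbhd v) \<inter> {..<j}) - k"
        by (simp only: card_Int_lessThan_Suc) simp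
      show ?thesis unfolding eq by (rule run_CondT[OF _ run_pop_k]) (use c True in blast)
    next
      case False
      with c show ?thesis
        by (intro run_CondF run_loop_free) (simp_all only: card_Int_lessThan_Suc, simp_all)
    qed
    have 2: "run (Mv 2 Rgt ;; Mv 0 Rgt ;; Mv 3 Rgt) ?s 3 (?S (Suc j))"
      by (rule run_loop_free) (auto simp: algebra_simps)
    show "run (Cond ?c pop_k (Mv 4 Stay) ;; Mv 2 Rgt ;; Mv 0 Rgt ;; Mv 3 Rgt) (?S j) (7 * k + 8) (?S (Suc j))"
      by (rule run_mono[OF run_Seq[OF 1 2]]) simp
  qed (auto simp: reads_defs)
  moreover have "U \<inter> nbhd v \<inter> {..<n} = U \<inter> nbhd v" using assms by auto
  ultimately show ?thesis
    by (simp add: pop_gain_def row_pos_def algebra_simps)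
qed

lemma run_row_back:
  assumes "\<And>j. j < n \<Longrightarrow> f j \<noteq> 0"
  shows "run row_back
     [input_at (row_pos (Suc v)), x, arr n f (int n), mark (int n - int v), s, a, b, c, d]
     (n * 4 + 7)
     [input_at (row_pos v), x, arr n f 0, mark (- int v), s, a, b, c, d]"
proof -
  let ?S = "\<lambda>j. [input_at (row_pos (Suc v) - 1 - int j), x, arr n f (int n - 1 - int j),
     mark (int n - int v - 1 - int j), s, a, b, c, d]"
  have 1: "run (Mv 2 Lft ;; Mv 0 Lft ;; Mv 3 Lft)
     [input_at (row_pos (Suc v)), x, arr n f (int n), mark (int n - int v), s, a, b, c, d] 3 (?S 0)"
    by (rule run_loop_free) auto
  have 2: "run (Loop (nonblank 2) (Mv 2 Lft ;; Mv 0 Lft ;; Mv 3 Lft)) (?S 0) (n * Suc 3 + 1) (?S n)"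
    by (rule run_Loop[where S = ?S])
      (use assms in \<open>auto intro!: run_loop_free simp: reads_defs algebra_simps\<close>)
  have 3: "run (Mv 2 Rgt ;; Mv 0 Rgt ;; Mv 3 Rgt) (?S n) 3
     [input_at (row_pos v), x, arr n f 0, mark (- int v), s, a, b, c, d]"
    by (rule run_loop_free) (auto simp: row_pos_def algebra_simps)
  show ?thesis unfolding row_back_def
    by (rule run_mono[OF run_Seq[OF 1 run_Seq[OF 2 3]]]) simp
qed

lemma run_row_forward:
  assumes "\<And>j. j < n \<Longrightarrow> f j \<noteq> 0"
  shows "run row_forward
     [input_at (row_pos v), x, arr n f 0, mark (- int v), s, a, b, c, d]
     (n * 4 + 1)
     [input_at (row_pos (Suc v)), x, arr n f (int n), mark (int n - int v), s, a, b, c, d]"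
  unfolding row_forward_def
  by (rule run_mono, rule run_Loop[where m = n and t = 3 and
      S = "\<lambda>j. [input_at (row_pos v + int j), x, arr n f (int j), mark (int j - int v), s, a, b, c, d]"])
    (use assms in \<open>auto intro!: run_loop_free simp: reads_defs row_pos_def algebra_simps\<close>)

lemma run_cover:
  assumes "v < n"
  shows "run cover
     [input_at (row_pos v), x, arr n (flags U) 0, mark (- int v), s, a, b, c, d]
     (n * 4 + 1)
     [input_at (row_pos (Suc v)), x, arr n (flags (U - nbhd v)) (int n), mark (int n - int v), s, a, b, c, d]"
proof -
  \<comment> \<open>\<open>\<inter>\<close> binds more tightly than \<open>-\<close>: only the cells
    left of the head have been updated.\<close>
  let ?S = "\<lambda>j. [input_at (row_pos v + int j), x, arr n (flags (U - nbhd v \<inter> {..<j})) (int j),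
     mark (int j - int v), s, a, b, c, d]"
  have "run cover (?S 0) (n * Suc 3 + 1) (?S n)"
    unfolding cover_def
  proof (rule run_Loop[where S = ?S])
    fix j assume j: "j < n"
    have "in_nbhd (map read (?S j)) \<longleftrightarrow> j \<in> nbhd v"
      using in_nbhd_iff[OF assms j] by (simp add: in_nbhd_def)
    then show "run (Wr 2 (\<lambda>ss. if in_nbhd ss then 1 else ss ! 2) Rgt ;; Mv 0 Rgt ;; Mv 3 Rgt)
        (?S j) 3 (?S (Suc j))"
      using j by (intro run_loop_free)
        (auto intro!: arr_cong simp: act_arr flags_def less_Suc_eq algebra_simps)
  qed (auto simp: reads_defs)
  moreover have "U - nbhd v \<inter> {..<n} = U - nbhd v" by (auto simp: nbhd_def)
  ultimately show ?thesis
    by (simp add: row_pos_def algebra_simps)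
qed

end

lemma act_output_tape_bits [simp]:
  "act (2, Rgt) (output_tape ys) = output_tape (ys @ [True])"
  "act (Suc 0, Rgt) (output_tape ys) = output_tape (ys @ [False])"
  using act_output_tape[of True ys] act_output_tape[of False ys]
  by (simp_all add: bit_symbol_def)

context instance_tape
begin

subsection \<open>The greedy phase\<close>

text \<open>The states of the greedy algorithm consist of the set of uncovered vertices, the array of
  selection marks, and the number of selected vertices.\<close>

definition row_step ::
  "nat \<Rightarrow> nat set \<times> (nat \<Rightarrow> nat) \<times> nat \<Rightarrow> nat set \<times> (nat \<Rightarrow> nat) \<times> nat" where
  "row_step v = (\<lambda>(U, f, c).
     if f v = 1 \<and> c < k \<and> card U \<le> k * card (U \<inter> nbhd v)
     then (U - nbhd v, f(v := selection_symbol c), Suc c) else (U, f, c))"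

definition rows :: "nat \<Rightarrow> nat set \<times> (nat \<Rightarrow> nat) \<times> nat \<Rightarrow> nat set \<times> (nat \<Rightarrow> nat) \<times> nat" where
  "rows v = fold row_step [0..<v]"

text \<open>Head 6 at position \<open>c\<close> supplies both the test \<open>c < k\<close>, by
  reading a nonblank, and the symbol for the next selection.\<close>

definition sweep_tapes :: "nat \<Rightarrow> nat set \<times> (nat \<Rightarrow> nat) \<times> nat \<Rightarrow> tape \<Rightarrow> tape \<Rightarrow> tape list" where
  "sweep_tapes v \<sigma> r y = (case \<sigma> of (U, f, c) \<Rightarrow>
     [input_at (row_pos v), arr n f (int v), arr n (flags U) 0, mark (- int v), stack 0, unary k 0,
      arr k selection_symbol (int c), r, y])"

text \<open>Just what the simulation relies on; nonzero marks let the loops find the ends of the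
  array. The counting properties are kept apart in \<open>greedy_invariant\<close>.\<close>

definition valid_state :: "nat set \<times> (nat \<Rightarrow> nat) \<times> nat \<Rightarrow> bool" where
  "valid_state = (\<lambda>(U, f, c). U \<subseteq> {..<n} \<and> c \<le> k \<and> (\<forall>i. f i \<noteq> 0))"

lemma valid_row_step: "valid_state \<sigma> \<Longrightarrow> valid_state (row_step v \<sigma>)"
  by (auto simp: valid_state_def row_step_def selection_symbol_def split: prod.splits if_splits)

lemma valid_rows: "valid_state \<sigma> \<Longrightarrow> valid_state (rows v \<sigma>)"
  by (induction v) (auto simp: rows_def valid_row_step)

lemma valid_sweeps: "valid_state \<sigma> \<Longrightarrow> valid_state ((rows n ^^ i) \<sigma>)"
  by (induction i) (auto simp: valid_rows)

text \<open>The per-cell costs 6, 2, 9, 4, 4, 2, 3 of the seven passes over a row add up to 30, and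
  \<open>7 * k\<close> comes from \<open>pop_k\<close>; 40 is a generous constant.\<close>

definition row_time :: nat where
  "row_time = n * (7 * k + 30) + 40"

lemma run_process_row:
  assumes v: "v < n" and \<sigma>: "valid_state \<sigma>"
  shows "run process_row (sweep_tapes v \<sigma> r y) row_time (sweep_tapes (Suc v) (row_step v \<sigma>) r y)"
proof -
  obtain U f c where \<sigma>_eq: "\<sigma> = (U, f, c)" by (metis surj_pair)
  have U: "U \<subseteq> {..<n}" "c \<le> k" using \<sigma> by (auto simp: \<sigma>_eq valid_state_def)
  have Un: "U \<inter> {..<n} = U" using U by auto
  have "card U \<le> n" using card_mono[OF _ U(1)] by simp
  let ?h = "card U - k * card (U \<inter> nbhd v)"
  let ?S = "\<lambda>q w p h. [input_at q, arr n f (int v), arr n (flags U) w, mark p, stack h, unary k 0,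
      arr k selection_symbol (int c), r, y]"
  have 1: "run push_uncovered (?S (row_pos v) 0 (- int v) 0) (n * 6 + 1)
      (?S (row_pos v) (int n) (- int v) (card U))"
    using run_push_uncovered[where U = U and n = n] by (simp only: Un)
  have 2: "run (rewind 2) (?S (row_pos v) (int n) (- int v) (card U)) (2 * n + 3)
      (?S (row_pos v) 0 (- int v) (card U))"
    using run_rewind[of 2 "?S (row_pos v) (int n) (- int v) (card U)" n "flags U" "int n"] by simp
  have 3: "run pop_gain (?S (row_pos v) 0 (- int v) (card U)) (n * (7 * k + 9) + 1)
      (?S (row_pos (Suc v)) (int n) (int n - int v) ?h)"
    by (rule run_pop_gain[OF v U(1)])
  have 4: "run row_back (?S (row_pos (Suc v)) (int n) (int n - int v) ?h) (n * 4 + 7)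
      (?S (row_pos v) 0 (- int v) ?h)"
    by (rule run_row_back) simp
  obtain U' f' c' where step: "row_step v \<sigma> = (U', f', c')" by (metis surj_pair)
  let ?S' = "\<lambda>x w p h. [input_at (row_pos (Suc v)), arr n f' x, arr n (flags U') w, mark p, stack h,
      unary k 0, arr k selection_symbol (int c'), r, y]"
  let ?c = "\<lambda>ss. ss ! 4 = 0 \<and> ss ! 1 = 1 \<and> ss ! 6 \<noteq> (0::nat)"
  \<comment> \<open>\<open>?h\<close> is a truncated difference, so the stack is empty exactly if
    the acceptance inequality holds.\<close>
  have c: "?c (map read (?S (row_pos v) 0 (- int v) ?h)) \<longleftrightarrow>
      f v = 1 \<and> c < k \<and> card U \<le> k * card (U \<inter> nbhd v)"
    using v by (auto simp: selection_symbol_def)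
  have 5: "run (Cond ?c ((Wr 1 (\<lambda>ss. ss ! 6) Stay ;; Mv 6 Rgt) ;; cover) row_forward)
      (?S (row_pos v) 0 (- int v) ?h) (Suc (2 + (n * 4 + 1))) (?S' (int v) (int n) (int n - int v) ?h)"
  proof (cases "?c (map read (?S (row_pos v) 0 (- int v) ?h))")
    case True
    with c step have *: "U' = U - nbhd v" "f' = f(v := selection_symbol c)" "c' = Suc c" "c < k"
      by (auto simp: \<sigma>_eq row_step_def)
    have "run (Wr 1 (\<lambda>ss. ss ! 6) Stay ;; Mv 6 Rgt) (?S (row_pos v) 0 (- int v) ?h) 2
      [input_at (row_pos v), arr n f' (int v), arr n (flags U) 0, mark (- int v), stack ?h,
      unary k 0, arr k selection_symbol (int c'), r, y]"
      by (rule run_loop_free) (use * v in \<open>auto simp: act_arr algebra_simps\<close>)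
    from run_Seq[OF this run_cover[OF v]] True show ?thesis
      unfolding *(1) by (intro run_CondT)
  next
    case False
    with c step have *: "U' = U" "f' = f" "c' = c"
      by (auto simp: \<sigma>_eq row_step_def)
    have "run row_forward (?S (row_pos v) 0 (- int v) ?h) (2 + (n * 4 + 1))
        (?S' (int v) (int n) (int n - int v) ?h)"
      unfolding * by (rule run_mono[OF run_row_forward]) auto
    with False show ?thesis by (rule run_CondF)
  qed
  have 6: "run clear_stack (?S' (int v) (int n) (int n - int v) ?h) (?h * 2 + 1)
      (?S' (int v) (int n) (int n - int v) 0)"
    by (rule run_clear_stack)
  have 7: "run next_row (?S' (int v) (int n) (int n - int v) 0) (n * 3 + 5)
      (?S' (int v + 1) 0 (int n - int v - int n - 1) 0)"
    by (rule run_next_row) simp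
  have time: "n * 6 + 1 + (2 * n + 3 + (n * (7 * k + 9) + 1 + (n * 4 + 7 +
      (Suc (2 + (n * 4 + 1)) + (?h * 2 + 1 + (n * 3 + 5)))))) \<le> row_time"
    using \<open>card U \<le> n\<close> by (simp add: row_time_def algebra_simps)
  have "run process_row (?S (row_pos v) 0 (- int v) 0) row_time
      (?S' (int v + 1) 0 (int n - int v - int n - 1) 0)"
    unfolding process_row_def
    by (rule run_mono[OF run_Seq[OF 1 run_Seq[OF 2 run_Seq[OF 3 run_Seq[OF 4
          run_Seq[OF 5 run_Seq[OF 6 7]]]]]] time])
  moreover have "int v + 1 = int (Suc v)" "int n - int v - int n - 1 = - int (Suc v)" by simp_all
  ultimately show ?thesis
    unfolding sweep_tapes_def step unfolding \<sigma>_eq by (simp only: prod.case of_nat_0 minus_zero)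
qed

lemma run_to_matrix:
  assumes "length s = 9" "s ! 0 = input_at p" "0 \<le> p" "p \<le> int (length input_word)"
  shows "run to_matrix s (2 * length input_word + 2 * n + 5) (s[0 := input_at (row_pos 0)])"
proof -
  have 1: "run (rewind 0) s (2 * length input_word + 3) (s[0 := input_at 0])"
    using run_rewind[of 0 s "length input_word" "\<lambda>i. bit_symbol (input_word ! i)" p] assms
    by (simp add: input_at_def)
  have read: "read (input_at (int j)) = 2 \<longleftrightarrow> j < n" if "j \<le> n" for j
    using read_input_at_size that by blast
  have 2: "run (Loop on_one (Mv 0 Rgt)) (s[0 := input_at 0]) (n * Suc 1 + 1) (s[0 := input_at (int n)])"
    by (rule run_Loop[where S = "\<lambda>j. s[0 := input_at (int j)]"])
      (use assms read in \<open>auto intro!: run_loop_free simp: on_one_def algebra_simps\<close>)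
  have 3: "run (Mv 0 Rgt) (s[0 := input_at (int n)]) 1 (s[0 := input_at (row_pos 0)])"
    using run_Mv[of 0 "s[0 := input_at (int n)]" Rgt] assms by (simp add: row_pos_def)
  show ?thesis unfolding to_matrix_def
    by (rule run_mono[OF run_Seq[OF 1 run_Seq[OF 2 3]]]) simp
qed

lemma row_pos_le: "v \<le> n \<Longrightarrow> row_pos v \<le> int (length input_word)"
proof -
  assume "v \<le> n"
  then have "int (v * n) \<le> int (n * n)" by (intro of_nat_mono mult_le_mono1)
  then show ?thesis by (simp add: row_pos_def length_input_word)
qed

lemma row_pos_nonneg: "0 \<le> row_pos v"
  by (simp add: row_pos_def)

definition sweep_time :: nat where
  "sweep_time = n * Suc row_time + 6 * n + 2 * length input_word + 10"

lemma run_sweep_rows: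
  assumes "valid_state \<sigma>"
  shows "run sweep_rows (sweep_tapes 0 \<sigma> r y) sweep_time (sweep_tapes 0 (rows n \<sigma>) r y)"
proof -
  have read1: "read (sweep_tapes v (rows v \<sigma>) r y ! 1) \<noteq> 0 \<longleftrightarrow> v < n" if "v \<le> n" for v
    using valid_rows[OF assms, of v] that
    by (auto simp: sweep_tapes_def valid_state_def split: prod.splits)
  have len: "length (sweep_tapes v \<sigma>' r y) = 9" for v \<sigma>'
    by (simp add: sweep_tapes_def split: prod.splits)
  have 1: "run (Loop (nonblank 1) process_row) (sweep_tapes 0 \<sigma> r y) (n * Suc row_time + 1)
      (sweep_tapes n (rows n \<sigma>) r y)"
    by (rule run_Loop[where S = "\<lambda>v. sweep_tapes v (rows v \<sigma>) r y"])
      (use read1 run_process_row[OF _ valid_rows[OF assms]] in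
        \<open>auto simp: nonblank_def len rows_def\<close>)
  obtain U f c where rows: "rows n \<sigma> = (U, f, c)" by (metis surj_pair)
  have f: "f i \<noteq> 0" for i using valid_rows[OF assms, of n] by (auto simp: rows valid_state_def)
  let ?S = "\<lambda>q x p. [input_at q, arr n f x, arr n (flags U) 0, mark p, stack 0, unary k 0,
      arr k selection_symbol (int c), r, y]"
  have 2: "run (rewind 1) (?S (row_pos n) (int n) (- int n)) (2 * n + 3) (?S (row_pos n) 0 (- int n))"
    using run_rewind[of 1 "?S (row_pos n) (int n) (- int n)" n f "int n"] f by simp
  have 3: "run to_matrix (?S (row_pos n) 0 (- int n)) (2 * length input_word + 2 * n + 5)
     (?S (row_pos 0) 0 (- int n))"
    using run_to_matrix[of "?S (row_pos n) 0 (- int n)" "row_pos n"] row_pos_le[of n]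
      row_pos_nonneg by simp
  \<comment> \<open>Head 3 has drifted to \<open>- n\<close> during the rows; the single mark lets
    it find cell 0 again.\<close>
  have 4: "run (Loop (\<lambda>ss. ss ! 3 = 0) (Mv 3 Rgt)) (?S (row_pos 0) 0 (- int n)) (n * Suc 1 + 1)
     (?S (row_pos 0) 0 0)"
    by (rule run_Loop[where S = "\<lambda>j. ?S (row_pos 0) 0 (- int n + int j)"])
      (auto intro!: run_loop_free simp: algebra_simps)
  have eq: "sweep_tapes n (rows n \<sigma>) r y = ?S (row_pos n) (int n) (- int n)"
    "sweep_tapes 0 (rows n \<sigma>) r y = ?S (row_pos 0) 0 0"
    by (simp_all add: sweep_tapes_def rows)
  show ?thesis unfolding sweep_rows_def eq
    by (rule run_mono[OF run_Seq[OF 1[unfolded eq] run_Seq[OF 2 run_Seq[OF 3 4]]]])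
      (simp add: sweep_time_def)
qed

lemma run_sweeps:
  assumes "valid_state \<sigma>"
  shows "run sweeps (sweep_tapes 0 \<sigma> (unary n 0) y) (n * (sweep_time + 2) + 1)
     (sweep_tapes 0 ((rows n ^^ n) \<sigma>) (unary n (int n)) y)"
proof -
  let ?S = "\<lambda>i. sweep_tapes 0 ((rows n ^^ i) \<sigma>) (unary n (int i)) y"
  have "run sweeps (?S 0) (n * Suc (sweep_time + 1) + 1) (?S n)"
    unfolding sweeps_def
  proof (rule run_Loop[where S = ?S])
    fix i assume "i < n"
    have "run (Mv 7 Rgt) (sweep_tapes 0 ((rows n ^^ Suc i) \<sigma>) (unary n (int i)) y) 1 (?S (Suc i))"
      by (rule run_loop_free) (auto simp: sweep_tapes_def algebra_simps split: prod.splits)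
    then show "run (sweep_rows ;; Mv 7 Rgt) (?S i) (sweep_time + 1) (?S (Suc i))"
      using run_sweep_rows[OF valid_sweeps[OF assms]] by (intro run_Seq) auto
  qed (auto simp: nonblank_def sweep_tapes_def split: prod.splits)
  then show ?thesis by simp
qed

subsection \<open>Initialization\<close>

definition init_time :: nat where
  "init_time = 30 * n + 6 * (n * n) + 20 * k + 2 * length input_word + 60"

lemma run_initialize:
  "run initialize (input_tape input_word # replicate 8 (input_tape [])) init_time
     (sweep_tapes 0 ({..<n}, \<lambda>_. 1, 0) (unary n 0) (output_tape []))"
proof -
  let ?S = "\<lambda>q x w r. [input_at q, arr n (\<lambda>_. 1) x, arr n (\<lambda>_. 2) w, arr 0 (\<lambda>_. 1) 0, arr 0 (\<lambda>_. 1) 0,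
      arr 0 (\<lambda>_. 1) 0, arr 0 (\<lambda>_. 4) 0, unary n r, output_tape []]"
  have read: "read (input_at (int j)) = 2 \<longleftrightarrow> j < n" if "j \<le> n" for j
    using read_input_at_size that by blast
  \<comment> \<open>A blank tape is an array of length 0 with any contents function;
    \<open>start\<close> chooses the function that the tape will have later, so that appending fits
    \<open>act_arr_append_const\<close>.\<close>
  have blank: "arr 0 f 0 = input_tape []" "output_tape [] = input_tape []" for f
    by (auto simp: output_tape_def input_tape_def arr_def)
  have start: "input_tape input_word # replicate 8 (input_tape []) = [input_at 0, arr 0 (\<lambda>_. 1) 0,
      arr 0 (\<lambda>_. 2) 0, arr 0 (\<lambda>_. 1) 0, arr 0 (\<lambda>_. 1) 0, arr 0 (\<lambda>_. 1) 0, arr 0 (\<lambda>_. 4) 0,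
      unary 0 0, output_tape []]"
    by (simp add: blank input_at_0 eval_nat_numeral)
  have 1: "run write_arrays (input_tape input_word # replicate 8 (input_tape [])) (n * Suc 4 + 1)
      (?S (int n) (int n) (int n) (int n))"
    unfolding write_arrays_def
    by (rule run_Loop[where S = "\<lambda>j. [input_at (int j), arr j (\<lambda>_. 1) (int j), arr j (\<lambda>_. 2) (int j),
            arr 0 (\<lambda>_. 1) 0, arr 0 (\<lambda>_. 1) 0, arr 0 (\<lambda>_. 1) 0, arr 0 (\<lambda>_. 4) 0, unary j (int j), output_tape []]"])
      (use read start in \<open>auto intro!: run_loop_free simp: on_one_def algebra_simps\<close>)
  have 2: "run (Mv 0 Rgt) (?S (int n) (int n) (int n) (int n)) 1 (?S (row_pos 0) (int n) (int n) (int n))"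
    by (rule run_loop_free) (auto simp: row_pos_def)
  have 3: "run (rewind 1) (?S (row_pos 0) (int n) (int n) (int n)) (2 * n + 3) (?S (row_pos 0) 0 (int n) (int n))"
    using run_rewind[of 1 "?S (row_pos 0) (int n) (int n) (int n)" n "\<lambda>_. 1" "int n"] by simp
  have 4: "run (rewind 2) (?S (row_pos 0) 0 (int n) (int n)) (2 * n + 3) (?S (row_pos 0) 0 0 (int n))"
    using run_rewind[of 2 "?S (row_pos 0) 0 (int n) (int n)" n "\<lambda>_. 2" "int n"] by simp
  have 5: "run (rewind 7) (?S (row_pos 0) 0 0 (int n)) (2 * n + 3) (?S (row_pos 0) 0 0 0)"
    using run_rewind[of 7 "?S (row_pos 0) 0 0 (int n)" n "\<lambda>_. 1" "int n"] by simp
  have 6: "run skip_matrix (?S (row_pos 0) 0 0 0) (n * Suc (n * 3 + 1 + (2 * n + 3 + 1)) + 1)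
      (?S (row_pos n) (int n) 0 0)"
    unfolding skip_matrix_def
  proof (rule run_Loop[where S = "\<lambda>v. ?S (row_pos v) (int v) 0 0"])
    fix v assume "v < n"
    have 1: "run (Loop (nonblank 2) (Mv 2 Rgt ;; Mv 0 Rgt)) (?S (row_pos v) (int v) 0 0) (n * 3 + 1)
        (?S (row_pos (Suc v)) (int v) (int n) 0)"
      by (rule run_mono, rule run_Loop[where t = 2 and m = n and S = "\<lambda>j. ?S (row_pos v + int j) (int v) (int j) 0"])
        (auto intro!: run_loop_free simp: nonblank_def row_pos_def algebra_simps)
    have 2: "run (rewind 2) (?S (row_pos (Suc v)) (int v) (int n) 0) (2 * n + 3)
        (?S (row_pos (Suc v)) (int v) 0 0)"
      using run_rewind[of 2 "?S (row_pos (Suc v)) (int v) (int n) 0" n "\<lambda>_. 2" "int n"] by simp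
    have 3: "run (Mv 1 Rgt) (?S (row_pos (Suc v)) (int v) 0 0) 1 (?S (row_pos (Suc v)) (int (Suc v)) 0 0)"
      by (rule run_loop_free) (auto simp: algebra_simps)
    show "run (Loop (nonblank 2) (Mv 2 Rgt ;; Mv 0 Rgt) ;; rewind 2 ;; Mv 1 Rgt)
        (?S (row_pos v) (int v) 0 0) (n * 3 + 1 + (2 * n + 3 + 1))
        (?S (row_pos (Suc v)) (int (Suc v)) 0 0)"
      by (rule run_Seq[OF 1 run_Seq[OF 2 3]])
  qed (auto simp: nonblank_def)
  have 7: "run (rewind 1) (?S (row_pos n) (int n) 0 0) (2 * n + 3) (?S (row_pos n) 0 0 0)"
    using run_rewind[of 1 "?S (row_pos n) (int n) 0 0" n "\<lambda>_. 1" "int n"] by simp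
  let ?R = "\<lambda>q m a b. [input_at q, arr n (\<lambda>_. 1) 0, arr n (\<lambda>_. 2) 0, arr 0 (\<lambda>_. 1) 0, arr 0 (\<lambda>_. 1) 0,
      unary m a, arr m (\<lambda>_. 4) b, unary n 0, output_tape []]"
  have 8: "run write_counters (?S (row_pos n) 0 0 0) (k * Suc 3 + 1) (?R (row_pos n + int k) k (int k) (int k))"
    unfolding write_counters_def
    by (rule run_Loop[where S = "\<lambda>j. ?R (row_pos n + int j) j (int j) (int j)"])
      (use read_input_at_param in \<open>auto intro!: run_loop_free simp: on_one_def algebra_simps\<close>)
  have 9: "run (rewind 5) (?R (row_pos n + int k) k (int k) (int k)) (2 * k + 3)
      (?R (row_pos n + int k) k 0 (int k))"
    using run_rewind[of 5 "?R (row_pos n + int k) k (int k) (int k)" k "\<lambda>_. 1" "int k"] by simp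
  have 10: "run (rewind 6) (?R (row_pos n + int k) k 0 (int k)) (2 * k + 3)
      (?R (row_pos n + int k) k 0 0)"
    using run_rewind[of 6 "?R (row_pos n + int k) k 0 (int k)" k "\<lambda>_. 4" "int k"] by simp
  let ?Q = "\<lambda>q. [input_at q, arr n (\<lambda>_. 1) 0, arr n (flags {..<n}) 0, mark 0, stack 0,
      unary k 0, arr k selection_symbol 0, unary n 0, output_tape []]"
  have mark: "act (Suc 0, Stay) (arr 0 (\<lambda>_. Suc 0) 0) = mark 0"
    using act_arr_append_const[of "Suc 0" Stay 0] by simp
  \<comment> \<open>For \<open>k = 0\<close> a blank is written onto a blank tape, so the array
    stays empty.\<close>
  have symbols: "act (if 0 < k then 3 else 0, Stay) (arr k (\<lambda>_. 4) 0) = arr k selection_symbol 0"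
    by (cases k) (auto simp: act_arr selection_symbol_def fun_eq_iff arr_def act_def)
  have 11: "run (Wr 6 (\<lambda>ss. if ss ! 6 = 0 then 0 else 3) Stay ;; Wr 3 (\<lambda>_. 1) Stay ;; Mv 4 Lft)
      (?R (row_pos n + int k) k 0 0) 3 (?Q (row_pos n + int k))"
    by (rule run_loop_free) (use symbols in \<open>auto simp: mark flags_def intro!: arr_cong split: if_splits\<close>)
  have 12: "run to_matrix (?Q (row_pos n + int k)) (2 * length input_word + 2 * n + 5) (?Q (row_pos 0))"
    using run_to_matrix[of "?Q (row_pos n + int k)" "row_pos n + int k"]
    by (simp add: row_pos_def length_input_word)
  have "run initialize (input_tape input_word # replicate 8 (input_tape [])) init_time (?Q (row_pos 0))"
    unfolding initialize_def
    by (rule run_mono[OF run_Seq[OF 1 run_Seq[OF 2 run_Seq[OF 3 run_Seq[OF 4 run_Seq[OF 5 run_Seq[OF 6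
        run_Seq[OF 7 run_Seq[OF 8 run_Seq[OF 9 run_Seq[OF 10 run_Seq[OF 11 12]]]]]]]]]]]])
      (simp add: init_time_def algebra_simps)
  then show ?thesis by (simp add: sweep_tapes_def)
qed

subsection \<open>The output phase\<close>

text \<open>For \<open>k = 0\<close> the count is reached at once, though the empty set dominates
  only the empty graph; the second conjunct rules this out.\<close>

definition successful :: "nat set \<times> (nat \<Rightarrow> nat) \<times> nat \<Rightarrow> bool" where
  "successful = (\<lambda>(U, f, c). c = k \<and> (k > 0 \<or> n = 0))"

text \<open>The joint symbols are 2 for uncovered, 3 for the first selected, 4 for the other selected and
  1 for the remaining vertices. If the greedy phase fails, all vertices get 1, so that the matrix is
  copied unchanged.\<close>

definition merged :: "nat set \<times> (nat \<Rightarrow> nat) \<times> nat \<Rightarrow> nat \<Rightarrow> nat" where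
  "merged \<sigma> = (case \<sigma> of (U, f, c) \<Rightarrow>
     (\<lambda>i. if successful \<sigma> then (if f i = 1 then flags U i else f i) else 1))"

lemma run_merge_arrays:
  assumes f: "\<And>i. f i \<noteq> 0" and c: "c \<le> k"
  shows "run merge_arrays
     [t, arr n f 0, arr n (flags U) 0, p, s, unary k 0, arr k selection_symbol (int c), r, y]
     (8 * n + 8)
     [t, arr n (merged (U, f, c)) 0, arr n (merged (U, f, c)) 0, p, s, unary k 0,
      arr k selection_symbol (int c), r, y]"
proof -
  let ?g = "merged (U, f, c)"
  let ?S = "\<lambda>f w i. [t, arr n f i, arr n w i, p, s, unary k 0, arr k selection_symbol (int c), r, y]"
  have g: "?g i \<noteq> 0" for i using f by (auto simp: merged_def)
  let ?M = "Loop (nonblank 1)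
     (Wr 2 (\<lambda>ss. if ss ! 1 = 1 then ss ! 2 else ss ! 1) Stay ;; Wr 1 (\<lambda>ss. ss ! 2) Rgt ;; Mv 2 Rgt)"
  let ?C = "Loop (nonblank 1) (Wr 2 (\<lambda>_. 1) Rgt ;; Wr 1 (\<lambda>_. 1) Rgt)"
  have succ: "success (map read (?S f (flags U) 0)) \<longleftrightarrow> successful (U, f, c)"
    using f c by (auto simp: success_def successful_def selection_symbol_def)
  have 1: "run (Cond success ?M ?C) (?S f (flags U) 0) (Suc (n * 4 + 1)) (?S ?g ?g (int n))"
  proof (cases "successful (U, f, c)")
    case True
    then have g_eq: "?g i = (if f i = 1 then flags U i else f i)" for i by (simp add: merged_def)
    let ?T = "\<lambda>j. ?S (\<lambda>i. if i < j then ?g i else f i) (\<lambda>i. if i < j then ?g i else flags U i) (int j)"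
    have "run ?M (?S f (flags U) 0) (n * Suc 3 + 1) (?S ?g ?g (int n))"
    proof (rule run_Loop[where S = ?T])
      fix j assume j: "j < n"
      show "run (Wr 2 (\<lambda>ss. if ss ! 1 = 1 then ss ! 2 else ss ! 1) Stay ;; Wr 1 (\<lambda>ss. ss ! 2) Rgt ;;
          Mv 2 Rgt) (?T j) 3 (?T (Suc j))"
        using j by (intro run_loop_free) (auto intro!: arr_cong simp: act_arr g_eq less_Suc_eq)
    qed (use f in \<open>auto simp: nonblank_def intro!: arr_cong\<close>)
    with True succ show ?thesis by (intro run_CondT) (auto intro: run_mono)
  next
    case False
    then have g_eq: "?g i = 1" for i by (simp add: merged_def)
    let ?T = "\<lambda>j. ?S (\<lambda>i. if i < j then 1 else f i) (\<lambda>i. if i < j then 1 else flags U i) (int j)"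
    have "run ?C (?S f (flags U) 0) (n * Suc 2 + 1) (?S ?g ?g (int n))"
    proof (rule run_Loop[where S = ?T])
      fix j assume j: "j < n"
      show "run (Wr 2 (\<lambda>_. 1) Rgt ;; Wr 1 (\<lambda>_. 1) Rgt) (?T j) 2 (?T (Suc j))"
        using j by (intro run_loop_free) (auto intro!: arr_cong simp: act_arr less_Suc_eq)
    qed (use f in \<open>auto simp: nonblank_def g_eq intro!: arr_cong\<close>)
    with False succ show ?thesis by (intro run_CondF) (auto intro: run_mono)
  qed
  let ?R = "[t, arr n ?g 0, arr n ?g (int n), p, s, unary k 0, arr k selection_symbol (int c), r, y]"
  have 2: "run (rewind 1) (?S ?g ?g (int n)) (2 * n + 3) ?R"
    using run_rewind[of 1 "?S ?g ?g (int n)" n ?g "int n"] g by simp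
  have 3: "run (rewind 2) ?R (2 * n + 3) (?S ?g ?g 0)"
    using run_rewind[of 2 ?R n ?g "int n"] g by simp
  show ?thesis unfolding merge_arrays_def
    by (rule run_mono[OF run_Seq[OF 1 run_Seq[OF 2 3]]]) simp
qed

lemma run_copy_ones:
  assumes "\<And>j. j \<le> m \<Longrightarrow> read (input_at (q + int j)) = 2 \<longleftrightarrow> j < m"
  shows "run copy_ones [input_at q, x, w, p, s, a, b, r, output_tape ys] (3 * m + 3)
     [input_at (q + int m + 1), x, w, p, s, a, b, r, output_tape (ys @ enc_nat m)]"
proof -
  let ?S = "\<lambda>j. [input_at (q + int j), x, w, p, s, a, b, r, output_tape (ys @ replicate j True)]"
  have 1: "run (Loop on_one (Wr 8 (\<lambda>_. 2) Rgt ;; Mv 0 Rgt)) (?S 0) (m * Suc 2 + 1) (?S m)"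
    by (rule run_Loop[where S = ?S])
      (use assms in \<open>auto intro!: run_loop_free simp: on_one_def algebra_simps replicate_append_same\<close>)
  have 2: "run (Wr 8 (\<lambda>_. 1) Rgt ;; Mv 0 Rgt) (?S m) 2
     [input_at (q + int m + 1), x, w, p, s, a, b, r, output_tape (ys @ enc_nat m)]"
    by (rule run_loop_free) (auto simp: enc_nat_def)
  show ?thesis unfolding copy_ones_def
    using run_mono[OF run_Seq[OF 1 2]] by simp
qed

text \<open>With the joint symbols this is a star centred at the first selected vertex, with the
  uncovered vertices as leaves. Both orders are listed because an edge has two matrix
  entries.\<close>

definition new_edge :: "(nat \<Rightarrow> nat) \<Rightarrow> nat \<Rightarrow> nat \<Rightarrow> bool" where
  "new_edge g v j \<longleftrightarrow> g v = 2 \<and> g j = 3 \<or> g v = 3 \<and> g j = 2"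

lemma run_write_matrix:
  assumes g: "\<And>i. g i \<noteq> 0"
  shows "run write_matrix
     [input_at (row_pos 0), arr n g 0, arr n g 0, p, s, a, b, r, output_tape ys] (n * (6 * n + 6) + 1)
     [input_at (row_pos n), arr n g (int n), arr n g 0, p, s, a, b, r,
      output_tape (ys @ concat (map (\<lambda>i. map (\<lambda>j. adj i j \<or> new_edge g i j) [0..<n]) [0..<n]))]"
proof -
  let ?bit = "\<lambda>i j. adj i j \<or> new_edge g i j"
  let ?S = "\<lambda>v. [input_at (row_pos v), arr n g (int v), arr n g 0, p, s, a, b, r,
      output_tape (ys @ concat (map (\<lambda>i. map (?bit i) [0..<n]) [0..<v]))]"
  have "run write_matrix (?S 0) (n * Suc (n * Suc 3 + 1 + (2 * n + 3 + 1)) + 1) (?S n)"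
    unfolding write_matrix_def
  proof (rule run_Loop[where S = ?S])
    fix v assume v: "v < n"
    let ?T = "\<lambda>q w j. [input_at q, arr n g (int v), arr n g w, p, s, a, b, r,
      output_tape (ys @ concat (map (\<lambda>i. map (?bit i) [0..<n]) [0..<v]) @ map (?bit v) [0..<j])]"
    have 1: "run (Loop (nonblank 2) (Wr 8 edge_bit Rgt ;; Mv 0 Rgt ;; Mv 2 Rgt))
        (?S v) (n * Suc 3 + 1) (?T (row_pos (Suc v)) (int n) n)"
    proof (rule run_Loop[where S = "\<lambda>j. ?T (row_pos v + int j) (int j) j"])
      fix j assume j: "j < n"
      have "edge_bit (map read (?T (row_pos v + int j) (int j) j)) = bit_symbol (?bit v j)"
        using v j by (simp add: edge_bit_def read_input_at_matrix new_edge_def)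
          (simp add: bit_symbol_def)
      then show "run (Wr 8 edge_bit Rgt ;; Mv 0 Rgt ;; Mv 2 Rgt)
          (?T (row_pos v + int j) (int j) j) 3 (?T (row_pos v + int (Suc j)) (int (Suc j)) (Suc j))"
        by (intro run_loop_free) (simp_all add: act_output_tape algebra_simps)
    qed (use g in \<open>auto simp: nonblank_def row_pos_def algebra_simps\<close>)
    have 2: "run (rewind 2) (?T (row_pos (Suc v)) (int n) n) (2 * n + 3) (?T (row_pos (Suc v)) 0 n)"
      using run_rewind[of 2 "?T (row_pos (Suc v)) (int n) n" n g "int n"] g by simp
    have 3: "run (Mv 1 Rgt) (?T (row_pos (Suc v)) 0 n) 1 (?S (Suc v))"
      by (rule run_loop_free) (auto simp: algebra_simps)
    show "run (Loop (nonblank 2) (Wr 8 edge_bit Rgt ;; Mv 0 Rgt ;; Mv 2 Rgt) ;; rewind 2 ;; Mv 1 Rgt)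
        (?S v) (n * Suc 3 + 1 + (2 * n + 3 + 1)) (?S (Suc v))"
      by (rule run_Seq[OF 1 run_Seq[OF 2 3]])
  qed (use g in \<open>auto simp: nonblank_def\<close>)
  moreover have "n * Suc (n * Suc 3 + 1 + (2 * n + 3 + 1)) + 1 = n * (6 * n + 6) + 1"
    by (simp add: algebra_simps)
  ultimately show ?thesis by (simp only: of_nat_0 upt_0 list.map concat.simps append_Nil2)
qed

lemma run_write_solution:
  assumes g: "\<And>i. g i \<noteq> 0" and c: "c \<le> k"
  shows "run write_solution
     [t, arr n g 0, w, p, s, unary k 0, arr k selection_symbol (int c), r, output_tape ys] (3 * n + 5)
     [t, arr n g (if successful (U, f, c) then int n else 0), w, p, s, unary k 0, arr k selection_symbol (int c), r,
      output_tape (ys @ (if successful (U, f, c)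
         then True # map (\<lambda>v. g v = 3 \<or> g v = 4) [0..<n] else [False]))]"
proof -
  let ?S = "\<lambda>i zs. [t, arr n g i, w, p, s, unary k 0, arr k selection_symbol (int c), r, output_tape (ys @ zs)]"
  have succ: "success (map read (?S 0 [])) \<longleftrightarrow> successful (U, f, c)"
    using g c by (auto simp: success_def successful_def selection_symbol_def)
  let ?L = "Loop (nonblank 1) (Wr 8 (\<lambda>ss. if ss ! 1 = 3 \<or> ss ! 1 = 4 then 2 else 1) Rgt ;; Mv 1 Rgt)"
  show ?thesis
  proof (cases "successful (U, f, c)")
    case True
    have 1: "run (Wr 8 (\<lambda>_. 2) Rgt) (?S 0 []) 1 (?S 0 [True])"
      by (rule run_loop_free) auto
    let ?T = "\<lambda>j. ?S (int j) (True # map (\<lambda>v. g v = 3 \<or> g v = 4) [0..<j])"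
    have 2: "run ?L (?S 0 [True]) (n * Suc 2 + 1) (?T n)"
      by (rule run_Loop[where S = ?T])
        (use g in \<open>auto intro!: run_loop_free simp: nonblank_def algebra_simps\<close>)
    have "run write_solution (?S 0 []) (3 * n + 5) (?T n)"
      unfolding write_solution_def
      by (rule run_mono[OF run_CondT[OF _ run_Seq[OF 1 2]]]) (use True succ in auto)
    with True show ?thesis by simp
  next
    case False
    have 1: "run (Wr 8 (\<lambda>_. 1) Rgt) (?S 0 []) 1 (?S 0 [False])"
      by (rule run_loop_free) auto
    have "run write_solution (?S 0 []) (3 * n + 5) (?S 0 [False])"
      unfolding write_solution_def
      by (rule run_mono[OF run_CondF[OF _ 1]]) (use False succ in auto)
    with False show ?thesis by simp
  qed
qed

definition final_state :: "nat set \<times> (nat \<Rightarrow> nat) \<times> nat" where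
  "final_state = (rows n ^^ n) ({..<n}, \<lambda>_. 1, 0)"

definition output_word :: "bool list" where
  "output_word = enc_nat n @
     concat (map (\<lambda>i. map (\<lambda>j. adj i j \<or> new_edge (merged final_state) i j) [0..<n]) [0..<n]) @
     enc_nat k @ (if successful final_state
       then True # map (\<lambda>v. merged final_state v = 3 \<or> merged final_state v = 4) [0..<n]
       else [False])"

definition total_time :: nat where
  "total_time = init_time + n * (sweep_time + 2) + 10 * (n * n) + 40 * n + 10 * k +
     2 * length input_word + 50"

lemma valid_final_state: "valid_state final_state"
  unfolding final_state_def by (rule valid_sweeps) (simp add: valid_state_def)

lemma domination_prog_outputs:
  "outputs_within (compile 9 5 domination_prog) input_word total_time output_word"
proof -
  obtain U f c where \<sigma>: "final_state = (U, f, c)" by (metis surj_pair)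
  have c: "c \<le> k" and f: "f i \<noteq> 0" for i
    using valid_final_state by (auto simp: \<sigma> valid_state_def)
  let ?g = "merged (U, f, c)"
  have g: "?g i \<noteq> 0" for i using f by (auto simp: merged_def)
  let ?L = "arr k selection_symbol (int c)"
  let ?R = "unary n (int n)"
  have 1: "run initialize (input_tape input_word # replicate 8 (input_tape [])) init_time
     (sweep_tapes 0 ({..<n}, \<lambda>_. 1, 0) (unary n 0) (output_tape []))"
    by (rule run_initialize)
  have "valid_state ({..<n}, \<lambda>_. 1, 0)" by (simp add: valid_state_def)
  from run_sweeps[OF this, of "output_tape []"]
  have 2: "run sweeps (sweep_tapes 0 ({..<n}, \<lambda>_. 1, 0) (unary n 0) (output_tape []))
     (n * (sweep_time + 2) + 1)
     [input_at (row_pos 0), arr n f 0, arr n (flags U) 0, mark 0, stack 0, unary k 0, ?L, ?R, output_tape []]"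
    unfolding final_state_def[symmetric] \<sigma> by (simp add: sweep_tapes_def)
  let ?S = "\<lambda>q x ys. [input_at q, arr n ?g x, arr n ?g 0, mark 0, stack 0, unary k 0, ?L, ?R, output_tape ys]"
  have 3: "run merge_arrays [input_at (row_pos 0), arr n f 0, arr n (flags U) 0, mark 0, stack 0,
      unary k 0, ?L, ?R, output_tape []] (8 * n + 8) (?S (row_pos 0) 0 [])"
    by (rule run_merge_arrays[OF f c])
  have 4: "run (rewind 0) (?S (row_pos 0) 0 []) (2 * length input_word + 3) (?S 0 0 [])"
    using run_rewind[of 0 "?S (row_pos 0) 0 []" "length input_word" "\<lambda>i. bit_symbol (input_word ! i)" "row_pos 0"]
      row_pos_nonneg[of 0] row_pos_le[of 0] by (simp add: input_at_def)
  have 5: "run copy_ones (?S 0 0 []) (3 * n + 3) (?S (row_pos 0) 0 (enc_nat n))"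
    using run_copy_ones[of n 0 "arr n ?g 0" "arr n ?g 0" "mark 0" "stack 0" "unary k 0" ?L ?R "[]"]
      read_input_at_size by (simp add: row_pos_def)
  let ?ys = "enc_nat n @ concat (map (\<lambda>i. map (\<lambda>j. adj i j \<or> new_edge ?g i j) [0..<n]) [0..<n])"
  have 6: "run write_matrix (?S (row_pos 0) 0 (enc_nat n)) (n * (6 * n + 6) + 1) (?S (row_pos n) (int n) ?ys)"
    by (rule run_write_matrix[OF g])
  have 7: "run (rewind 1) (?S (row_pos n) (int n) ?ys) (2 * n + 3) (?S (row_pos n) 0 ?ys)"
    using run_rewind[of 1 "?S (row_pos n) (int n) ?ys" n ?g "int n"] g by simp
  have 8: "run copy_ones (?S (row_pos n) 0 ?ys) (3 * k + 3) (?S (row_pos n + int k + 1) 0 (?ys @ enc_nat k))"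
    by (rule run_copy_ones[OF read_input_at_param])
  let ?zs = "(?ys @ enc_nat k) @ (if successful (U, f, c)
         then True # map (\<lambda>v. ?g v = 3 \<or> ?g v = 4) [0..<n] else [False])"
  have 9: "run write_solution (?S (row_pos n + int k + 1) 0 (?ys @ enc_nat k)) (3 * n + 5)
     (?S (row_pos n + int k + 1) (if successful (U, f, c) then int n else 0) ?zs)"
    by (rule run_write_solution[OF g c])
  have "run domination_prog (input_tape input_word # replicate (9 - 1) (input_tape [])) total_time
     (?S (row_pos n + int k + 1) (if successful (U, f, c) then int n else 0) ?zs)"
    unfolding domination_prog_def
    by (rule run_mono, rule run_Seq[OF _ run_Seq[OF 2 run_Seq[OF 3 run_Seq[OF 4 run_Seq[OF 5
        run_Seq[OF 6 run_Seq[OF 7 run_Seq[OF 8 9]]]]]]]])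
      (use 1 in simp, simp add: total_time_def algebra_simps)
  moreover have "output_word = ?zs" by (simp add: output_word_def \<sigma>)
  ultimately show ?thesis
    by (intro run_imp_outputs_within) (auto simp: tape_holds_output_tape)
qed

end

section \<open>Correctness of the greedy algorithm\<close>

text \<open>From \<open>1 + x \<le> exp x\<close> at \<open>x = - 1 / k\<close>: the factor
  \<open>(1 - 1 / k) ^ k\<close> is at most \<open>1 / exp 1\<close>.\<close>

lemma card_le_exp_bound:
  fixes u n k :: nat
  assumes "u * k ^ k \<le> n * (k - 1) ^ k" "k > 0"
  shows "real u \<le> real n / exp 1"
proof -
  have "real u * real k ^ k \<le> real n * (real k - 1) ^ k"
    using of_nat_mono[OF assms(1), where 'a = real] assms(2) by (simp add: of_nat_diff)
  then have u: "real u \<le> real n * ((real k - 1) / real k) ^ k"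
    using assms(2) by (simp add: field_simps)
  have "((real k - 1) / real k) ^ k = (1 + (- 1 / real k)) ^ k"
    using assms(2) by (simp add: field_simps)
  also have "\<dots> \<le> exp (- 1 / real k) ^ k"
    using assms(2) by (intro power_mono exp_ge_add_one_self) (auto simp: field_simps)
  also have "exp (- 1 / real k) ^ k = 1 / exp 1"
    using assms(2) by (simp add: exp_of_nat_mult[symmetric] exp_minus field_simps)
  finally have "real n * ((real k - 1) / real k) ^ k \<le> real n * (1 / exp 1)"
    by (rule mult_left_mono) simp
  with u show ?thesis by simp
qed

context instance_tape
begin

definition selected :: "(nat \<Rightarrow> nat) \<Rightarrow> nat set" where
  "selected f = {v. v < n \<and> f v \<noteq> 1}"

text \<open>The inequality is \<open>card U \<le> n * (1 - 1 / k) ^ c\<close> without divisions.\<close>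

definition greedy_invariant :: "nat set \<times> (nat \<Rightarrow> nat) \<times> nat \<Rightarrow> bool" where
  "greedy_invariant = (\<lambda>(U, f, c).
     c \<le> k \<and> (\<forall>i. f i \<in> {1, 3, 4}) \<and> U = {..<n} - \<Union> (nbhd ` selected f) \<and>
     card (selected f) = c \<and> card U * k ^ c \<le> n * (k - 1) ^ c \<and>
     card {v. v < n \<and> f v = 3} = (if c = 0 then 0 else 1))"

definition dominates :: "nat set \<Rightarrow> bool" where
  "dominates D \<longleftrightarrow> D \<subseteq> {..<n} \<and> \<Union> (nbhd ` D) = {..<n}"

lemma finite_selected [simp]: "finite (selected f)"
  by (simp add: selected_def)

text \<open>An accepted vertex covers at least a share \<open>1 / k\<close> of \<open>U\<close>, so
  every selection multiplies the bound by \<open>1 - 1 / k\<close>. The symbol 3 is given out only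
  for \<open>c = 0\<close>, hence the last clause of the invariant.\<close>

lemma greedy_invariant_row_step:
  assumes v: "v < n" and inv: "greedy_invariant \<sigma>"
  shows "greedy_invariant (row_step v \<sigma>)"
proof -
  obtain U f c where \<sigma>: "\<sigma> = (U, f, c)" by (metis surj_pair)
  have I: "c \<le> k" "\<And>i. f i \<in> {1, 3, 4}" "U = {..<n} - \<Union> (nbhd ` selected f)"
     "card (selected f) = c" "card U * k ^ c \<le> n * (k - 1) ^ c"
     "card {v. v < n \<and> f v = 3} = (if c = 0 then 0 else 1)"
    using inv unfolding \<sigma> greedy_invariant_def by blast+
  show ?thesis
  proof (cases "f v = 1 \<and> c < k \<and> card U \<le> k * card (U \<inter> nbhd v)")
    case False
    then have "row_step v \<sigma> = \<sigma>" unfolding \<sigma> row_step_def by (simp only: prod.case if_False)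
    with inv show ?thesis by simp
  next
    case True
    let ?f = "f(v := selection_symbol c)"
    have step: "row_step v \<sigma> = (U - nbhd v, ?f, Suc c)"
      using True unfolding \<sigma> row_step_def by simp
    have sel: "selected ?f = insert v (selected f)" and nin: "v \<notin> selected f"
      using v True by (auto simp: selected_def selection_symbol_def)
    have "Suc c \<le> k" using True by simp
    have "finite U" using I by simp
    have "card (U - nbhd v) + card (U \<inter> nbhd v) = card U"
      using card_Int_Diff[OF \<open>finite U\<close>, of "nbhd v"] by simp
    then have "k * card (U - nbhd v) + k * card (U \<inter> nbhd v) = k * card U"
      by (metis distrib_left)
    then have "k * card (U - nbhd v) \<le> (k - 1) * card U"
      using True by (cases k) (auto simp: algebra_simps)
    then have "k * card (U - nbhd v) * k ^ c \<le> (k - 1) * card U * k ^ c"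
      by (rule mult_le_mono1)
    also have "\<dots> \<le> (k - 1) * (n * (k - 1) ^ c)"
      unfolding mult.assoc using I(5) by (rule mult_le_mono2)
    finally have "card (U - nbhd v) * k ^ Suc c \<le> n * (k - 1) ^ Suc c"
      by (simp add: algebra_simps)
    moreover have "card {w. w < n \<and> ?f w = 3} = (if Suc c = 0 then 0 else 1)"
    proof (cases "c = 0")
      case True
      then have "{w. w < n \<and> f w = 3} = {}" using I by simp
      with True v have "{w. w < n \<and> ?f w = 3} = {v}" by (auto simp: selection_symbol_def)
      then show ?thesis by simp
    next
      case False
      with True have "{w. w < n \<and> ?f w = 3} = {w. w < n \<and> f w = 3}"
        by (auto simp: selection_symbol_def)
      with I False show ?thesis by simp
    qed
    moreover have "card (selected ?f) = Suc c" using nin I(4) unfolding sel by simp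
    moreover have "U - nbhd v = {..<n} - \<Union> (nbhd ` selected ?f)" unfolding sel I(3) by auto
    moreover have "\<forall>i. ?f i \<in> {1, 3, 4}" using I(2) by (auto simp: selection_symbol_def)
    ultimately show ?thesis
      unfolding step greedy_invariant_def prod.case using \<open>Suc c \<le> k\<close> by blast
  qed
qed

lemma greedy_invariant_rows: "greedy_invariant \<sigma> \<Longrightarrow> m \<le> n \<Longrightarrow> greedy_invariant (rows m \<sigma>)"
  by (induction m) (auto simp: rows_def greedy_invariant_row_step)

lemma greedy_invariant_sweeps: "greedy_invariant \<sigma> \<Longrightarrow> greedy_invariant ((rows n ^^ i) \<sigma>)"
  by (induction i) (auto simp: greedy_invariant_rows)

lemma greedy_invariant_init: "greedy_invariant ({..<n}, \<lambda>_. 1, 0)"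
  by (auto simp: greedy_invariant_def selected_def)

text \<open>Averaging over \<open>D\<close>: its \<open>k\<close> neighbourhoods cover
  \<open>U\<close>, so one of them meets a nonempty \<open>U\<close> in at least
  \<open>card U / k > 0\<close> vertices. Its vertex is new, as neighbourhoods of selected vertices
  are disjoint from \<open>U\<close>. For \<open>U = {}\<close> every vertex passes the inequality,
  and \<open>c < k \<le> n\<close> leaves an unselected one.\<close>

lemma exists_gain:
  assumes D: "dominates D" "card D = k" and inv: "greedy_invariant (U, f, c)" and c: "c < k"
  shows "\<exists>v<n. f v = 1 \<and> card U \<le> k * card (U \<inter> nbhd v)"
proof (cases "U = {}")
  case True
  have "k \<le> n"
    using D card_mono[of "{..<n}" D] by (simp add: dominates_def)
  with c inv have "card (selected f) < card {..<n}" by (simp add: greedy_invariant_def)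
  then obtain v where "v < n" "v \<notin> selected f"
    by (metis card_mono finite_selected lessThan_iff not_le subsetI)
  with True show ?thesis by (auto simp: selected_def)
next
  case False
  have inv': "U = {..<n} - \<Union> (nbhd ` selected f)" using inv by (simp add: greedy_invariant_def)
  then have "finite U" by simp
  have "finite D" using c D by (metis card.infinite not_less_zero)
  have "U = (\<Union>v\<in>D. U \<inter> nbhd v)" using D inv' by (auto simp: dominates_def)
  then have "card U \<le> (\<Sum>v\<in>D. card (U \<inter> nbhd v))"
    using card_UN_le[OF \<open>finite D\<close>, of "\<lambda>v. U \<inter> nbhd v"] by simp
  then have sum: "k * card U \<le> (\<Sum>v\<in>D. k * card (U \<inter> nbhd v))"
    by (simp add: sum_distrib_left[symmetric])
  obtain v where v: "v \<in> D" "card U \<le> k * card (U \<inter> nbhd v)"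
  proof (rule ccontr)
    assume "\<not> thesis"
    with that have "\<forall>v\<in>D. k * card (U \<inter> nbhd v) < card U" by (meson not_le)
    moreover have "D \<noteq> {}" using D c by auto
    ultimately have "(\<Sum>v\<in>D. k * card (U \<inter> nbhd v)) < (\<Sum>v\<in>D. card U)"
      using \<open>finite D\<close> by (intro sum_strict_mono) auto
    with sum D show False by simp
  qed
  have "card U > 0" using False \<open>finite U\<close> by (simp add: card_gt_0_iff)
  with v have "card (U \<inter> nbhd v) > 0" by (metis le_zero_eq mult_0_right neq0_conv not_le)
  then have "U \<inter> nbhd v \<noteq> {}" by auto
  then have "v \<notin> selected f" using inv' by auto
  moreover have "v < n" using v D by (auto simp: dominates_def)
  ultimately show ?thesis using v by (auto simp: selected_def)
qed

section \<open>Progress of the sweeps\<close>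

abbreviation count :: "nat set \<times> (nat \<Rightarrow> nat) \<times> nat \<Rightarrow> nat" where
  "count \<sigma> \<equiv> snd (snd \<sigma>)"

lemma count_row_step:
  "count \<sigma> \<le> count (row_step v \<sigma>)" "count (row_step v \<sigma>) = count \<sigma> \<Longrightarrow> row_step v \<sigma> = \<sigma>"
  by (auto simp: row_step_def split: prod.splits if_splits)

lemma count_rows: "count \<sigma> \<le> count (rows m \<sigma>)"
  by (induction m) (auto simp: rows_def intro: count_row_step(1) order_trans)

text \<open>The count never decreases and every change of the state raises it, so an unchanged total
  leaves no change halfway: all vertices were tested against the same state.\<close>

lemma count_rows_eqD:
  "count (rows m \<sigma>) = count \<sigma> \<Longrightarrow> rows m \<sigma> = \<sigma> \<and> (\<forall>v<m. row_step v \<sigma> = \<sigma>)"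
proof (induction m)
  case (Suc m)
  have rows_Suc: "rows (Suc m) \<sigma> = row_step m (rows m \<sigma>)" by (simp add: rows_def)
  then have "count (rows m \<sigma>) = count \<sigma>"
    using Suc.prems count_rows[of \<sigma> m] count_row_step(1)[of "rows m \<sigma>" m] by simp
  with Suc have "rows m \<sigma> = \<sigma>" "\<forall>v<m. row_step v \<sigma> = \<sigma>" by auto
  with Suc.prems rows_Suc count_row_step(2)[of m \<sigma>] show ?case by (auto simp: less_Suc_eq)
qed (simp add: rows_def)

lemma count_rows_less:
  assumes D: "dominates D" "card D = k" and inv: "greedy_invariant \<sigma>" and c: "count \<sigma> < k"
  shows "count \<sigma> < count (rows n \<sigma>)"
proof (rule ccontr)
  assume "\<not> ?thesis"
  then have "count (rows n \<sigma>) = count \<sigma>" using count_rows[of \<sigma> n] by simp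
  then have same: "\<forall>v<n. row_step v \<sigma> = \<sigma>" using count_rows_eqD by blast
  obtain U f c where \<sigma>: "\<sigma> = (U, f, c)" by (metis surj_pair)
  have "greedy_invariant (U, f, c)" "c < k" using inv c \<sigma> by simp_all
  from exists_gain[OF D this] obtain v where "v < n" "f v = 1" "card U \<le> k * card (U \<inter> nbhd v)"
    by blast
  with same c show False by (auto simp: \<sigma> row_step_def)
qed

lemma greedy_invariant_final_state: "greedy_invariant final_state"
  unfolding final_state_def by (intro greedy_invariant_sweeps greedy_invariant_init)

lemma successful_if_dominates:
  assumes D: "dominates D" "card D = k"
  shows "successful final_state"
proof -
  let ?\<sigma> = "\<lambda>i. (rows n ^^ i) ({..<n}, \<lambda>_. 1, 0)"
  \<comment> \<open>Each sweep adds at least one selection as long as fewer than \<open>k\<close>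
    exist; for \<open>i = n \<ge> k\<close> the minimum is \<open>k\<close>.\<close>
  have "min i k \<le> count (?\<sigma> i)" for i
  proof (induction i)
    case (Suc i)
    show ?case
    proof (cases "count (?\<sigma> i) < k")
      case True
      then have "count (?\<sigma> i) < count (?\<sigma> (Suc i))"
        using count_rows_less[OF D greedy_invariant_sweeps[OF greedy_invariant_init], of i]
        by (simp only: funpow.simps comp_apply)
      with Suc True show ?thesis by linarith
    next
      case False
      then show ?thesis using count_rows[of "?\<sigma> i" n] by simp
    qed
  qed simp
  moreover have "k \<le> n"
    using D card_mono[of "{..<n}" D] by (simp add: dominates_def)
  ultimately have "k \<le> count final_state" by (metis final_state_def min.absorb2)
  \<comment> \<open>A dominating set of size 0 is empty, and its neighbourhoods cover
    nothing.\<close>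
  moreover have "k > 0 \<or> n = 0"
  proof (cases "k = 0")
    case True
    with D have "D = {}" using finite_subset[of D "{..<n}"] by (auto simp: dominates_def)
    with D show ?thesis by (auto simp: dominates_def)
  qed simp
  ultimately show ?thesis
    using greedy_invariant_final_state
    by (auto simp: successful_def greedy_invariant_def split: prod.splits)
qed

end

section \<open>From the output word back to graphs\<close>

definition extended_graph :: "nat graph \<Rightarrow> (nat \<Rightarrow> nat \<Rightarrow> bool) \<Rightarrow> nat graph" where
  "extended_graph G E = G\<lparr>edges := edges G \<union> {{u, s} |u s. u \<in> verts G \<and> s \<in> verts G \<and> E u s}\<rparr>"

lemma extended_graph_simps:
  "verts (extended_graph G E) = verts G"
  "edges (extended_graph G E) = edges G \<union> {{u, s} |u s. u \<in> verts G \<and> s \<in> verts G \<and> E u s}"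
  by (simp_all add: extended_graph_def)

text \<open>One graph \<open>H\<close> serves both outcomes: on failure all merged symbols are 1, so
  no edge is added and \<open>H\<close> is \<open>G\<close> at distance 0. On success the selected
  vertices dominate \<open>H\<close>, the uncovered vertices through the star and all others already
  in \<open>G\<close>.\<close>

lemma greedy_output_correct:
  assumes I: "(G, k) \<in> graph_inputs"
  defines "n \<equiv> card (verts G)" and "adj \<equiv> (\<lambda>i j. {i, j} \<in> edges G)"
  shows "\<exists>J a. instance_tape.output_word n k adj = enc_output (J, a) \<and>
    correct (Rel Dominating_Set dist_E_param (\<lambda>n. ennreal (real n / exp 1))) (G, k) (J, a)"
proof -
  interpret instance_tape n k adj .
  have G: "simple_graph G" "k \<le> n" and V: "verts G = {..<n}"
    using I unfolding graph_inputs_def n_def by blast+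
  obtain U f c where \<sigma>: "final_state = (U, f, c)" by (metis surj_pair)
  define g where "g = merged final_state"
  have inv: "c \<le> k" "\<And>i. f i \<in> {1, 3, 4}" "U = {..<n} - \<Union> (nbhd ` selected f)"
     "card (selected f) = c" "card U * k ^ c \<le> n * (k - 1) ^ c"
     "card {v. v < n \<and> f v = 3} = (if c = 0 then 0 else 1)"
    using greedy_invariant_final_state unfolding \<sigma> greedy_invariant_def by blast+
  have dom: "dominates S \<longleftrightarrow> dominating_set G S" for S
  proof (cases "S \<subseteq> {..<n}")
    case True
    have "{u, v} \<in> edges G \<Longrightarrow> u < n" for u v
      using G(1) V by (auto simp: simple_graph_def)
    with True have "\<Union> (nbhd ` S) = closed_nbhd G S"
      unfolding nbhd_def unfolding adj_def closed_nbhd_def by (auto simp: insert_commute)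
    with True V show ?thesis by (simp add: dominates_def dominating_set_def)
  next
    case False
    with V show ?thesis by (auto simp: dominates_def dominating_set_def)
  qed
  define H where "H = extended_graph G (new_edge g)"
  have new_sym: "new_edge g u v \<longleftrightarrow> new_edge g v u" for u v by (auto simp: new_edge_def)
  have H_verts: "verts H = {..<n}" by (simp add: H_def extended_graph_simps V)
  have H_edge: "{i, j} \<in> edges H \<longleftrightarrow> adj i j \<or> new_edge g i j" if "i < n" "j < n" for i j
    using that new_sym by (auto simp: H_def extended_graph_simps adj_def V doubleton_eq_iff)
  have "card {u, v} = 2" if "new_edge g u v" for u v
    using that by (auto simp: new_edge_def card_insert_if)
  then have "simple_graph H"
    using G(1) by (auto simp: simple_graph_def H_def extended_graph_simps)
  then have H: "(H, k) \<in> graph_inputs"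
    using G(2) by (simp add: graph_inputs_def H_verts)
  have enc_H: "enc_input (H, k) = enc_nat n @
      concat (map (\<lambda>i. map (\<lambda>j. adj i j \<or> new_edge g i j) [0..<n]) [0..<n]) @ enc_nat k"
  proof -
    have "map (\<lambda>j. {i, j} \<in> edges H) [0..<n] = map (\<lambda>j. adj i j \<or> new_edge g i j) [0..<n]" if "i < n" for i
      using that H_edge by simp
    then have "map (\<lambda>i. map (\<lambda>j. {i, j} \<in> edges H) [0..<n]) [0..<n] =
        map (\<lambda>i. map (\<lambda>j. adj i j \<or> new_edge g i j) [0..<n]) [0..<n]" by (intro map_cong) auto
    then show ?thesis
      by (simp only: enc_input_def enc_graph_def Let_def fst_conv snd_conv H_verts card_lessThan append_assoc)
  qed
  show ?thesis
  proof (cases "successful final_state")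
    case False
    then have "\<not> new_edge g i j" for i j
      by (auto simp: g_def merged_def new_edge_def split: prod.splits)
    then have "H = G" by (simp add: H_def extended_graph_def)
    have "\<not> (dominating_set G S \<and> card S = k)" for S
      using successful_if_dominates False dom by blast
    then have "correct (Rel Dominating_Set dist_E_param (\<lambda>n. ennreal (real n / exp 1))) (G, k) ((H, k), None)"
      using I \<open>H = G\<close>
      by (simp add: Rel_def Dominating_Set_def search_problem_def dist_E_param_def dist_E_def)
    moreover have "output_word = enc_output ((H, k), None)"
      using False enc_H by (simp add: output_word_def enc_output_def g_def)
    ultimately show ?thesis by blast
  next
    case True
    then have c: "c = k" "k > 0 \<or> n = 0" by (auto simp: \<sigma> successful_def)
    have g: "g i = (if f i = 1 then flags U i else f i)" for i
      using True by (simp add: g_def merged_def \<sigma>)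
    \<comment> \<open>Each vertex lies in its own closed neighbourhood, so merging never hides an
      uncovered vertex behind a selection mark.\<close>
    have f1: "f u = 1" if "u \<in> U" for u
      using that inv(3) by (auto simp: selected_def nbhd_def)
    have g2: "g u = 2 \<longleftrightarrow> u \<in> U" for u using inv(2)[of u] f1 by (auto simp: g flags_def)
    have g3: "g u = 3 \<longleftrightarrow> f u = 3" for u using inv(2)[of u] by (auto simp: g flags_def)
    have g34: "g u = 3 \<or> g u = 4 \<longleftrightarrow> f u \<noteq> 1" for u using inv(2)[of u] by (auto simp: g flags_def)
    let ?S = "selected f"
    have "finite U" "U \<subseteq> {..<n}" using inv(3) by auto
    have first: "\<exists>s<n. f s = 3 \<and> (\<forall>v<n. f v = 3 \<longrightarrow> v = s)" if "c > 0"
    proof -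
      from inv(6) that obtain s where s: "{v. v < n \<and> f v = 3} = {s}"
        by (auto simp: card_1_singleton_iff)
      have "s \<in> {v. v < n \<and> f v = 3}" unfolding s by simp
      moreover have "v = s" if "v < n" "f v = 3" for v
      proof -
        have "v \<in> {v. v < n \<and> f v = 3}" using that by simp
        then show ?thesis unfolding s by simp
      qed
      ultimately show ?thesis by blast
    qed
    have "dominating_set H ?S"
    proof -
      have "u \<in> closed_nbhd H ?S" if u: "u < n" for u
      proof (cases "u \<in> U")
        case True
        \<comment> \<open>\<open>u < n\<close> excludes \<open>n = 0\<close>, so
          \<open>k > 0\<close> and a first selected vertex exists.\<close>
        with u c first obtain s where s: "s < n" "f s = 3" by auto
        with True u have "{u, s} \<in> edges H" by (simp add: H_edge new_edge_def g2 g3)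
        with s show ?thesis by (auto simp: closed_nbhd_def selected_def)
      next
        case False
        with u inv(3) obtain v where v: "v \<in> ?S" "u \<in> nbhd v" by auto
        then have "u = v \<or> {u, v} \<in> edges G" unfolding nbhd_def by (auto simp: adj_def insert_commute)
        with v show ?thesis by (auto simp: closed_nbhd_def H_def extended_graph_simps)
      qed
      moreover have "closed_nbhd H ?S \<subseteq> {..<n}"
        using \<open>simple_graph H\<close> by (auto simp: closed_nbhd_def selected_def simple_graph_def H_verts)
      ultimately show ?thesis by (auto simp: dominating_set_def H_verts selected_def)
    qed
    have new: "edges H - edges G \<subseteq> {{u, s} |u s. u \<in> U \<and> s < n \<and> f s = 3}"
      by (auto simp: H_def extended_graph_simps new_edge_def g2 g3 V)
    have "card (edges H - edges G) \<le> card U"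
    proof (cases "c = 0")
      case True
      then have "{v. v < n \<and> f v = 3} = {}" using inv(6) by simp
      then have "edges H - edges G = {}" using new by blast
      then show ?thesis by (simp only: card.empty le0)
    next
      case False
      with first obtain s where "s < n" "\<forall>v<n. f v = 3 \<longrightarrow> v = s" by auto
      \<comment> \<open>With the centre \<open>s\<close> fixed, an added edge is determined by its
        end in \<open>U\<close>.\<close>
      then have "edges H - edges G \<subseteq> (\<lambda>u. {u, s}) ` U" using new by blast
      then show ?thesis using \<open>finite U\<close> by (rule surj_card_le[rotated])
    qed
    moreover have "(edges G - edges H) \<union> (edges H - edges G) = edges H - edges G"
      by (auto simp: H_def extended_graph_simps)
    ultimately have "dist_E G H \<le> of_nat (card U)"
      by (simp only: dist_E_def H_verts V if_True refl of_nat_mono)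
    also have "\<dots> = ennreal (real (card U))" by (simp add: ennreal_of_nat_eq_real_of_nat)
    also have "\<dots> \<le> ennreal (real n / exp 1)"
    \<comment> \<open>If \<open>k = 0\<close>, success means \<open>n = 0\<close> and both sides
      vanish; otherwise \<open>c = k\<close> turns the invariant into the premise of
      \<open>card_le_exp_bound\<close>.\<close>
    proof (rule ennreal_leI, cases "k = 0")
      case True
      with c \<open>U \<subseteq> {..<n}\<close> show "real (card U) \<le> real n / exp 1" by simp
    next
      case False
      with inv(5) c show "real (card U) \<le> real n / exp 1" by (intro card_le_exp_bound) auto
    qed
    finally have "correct (Rel Dominating_Set dist_E_param (\<lambda>n. ennreal (real n / exp 1))) (G, k) ((H, k), Some ?S)"
      using H \<open>dominating_set H ?S\<close> inv(4) c
      by (simp add: Rel_def Dominating_Set_def search_problem_def dist_E_param_def n_def)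
    moreover have "output_word = enc_output ((H, k), Some ?S)"
      using True enc_H
      by (simp add: output_word_def enc_output_def g_def[symmetric] g34 H_verts selected_def)
    ultimately show ?thesis by blast
  qed
qed

section \<open>Polynomial running time\<close>

text \<open>Closure under sums and products spares the explicit coefficients of the time
  polynomial.\<close>

definition poly_bounded :: "(nat \<Rightarrow> nat) \<Rightarrow> bool" where
  "poly_bounded f \<longleftrightarrow> (\<exists>p :: nat poly. \<forall>x. f x \<le> poly p x)"

lemma poly_bounded_const: "poly_bounded (\<lambda>_. c)"
  unfolding poly_bounded_def by (rule exI[of _ "[:c:]"]) simp

lemma poly_bounded_id: "poly_bounded (\<lambda>x. x)"
  unfolding poly_bounded_def by (rule exI[of _ "[:0, 1:]"]) simp

lemma poly_bounded_add: "poly_bounded f \<Longrightarrow> poly_bounded g \<Longrightarrow> poly_bounded (\<lambda>x. f x + g x)"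
  unfolding poly_bounded_def by (metis add_mono poly_add)

lemma poly_bounded_mult: "poly_bounded f \<Longrightarrow> poly_bounded g \<Longrightarrow> poly_bounded (\<lambda>x. f x * g x)"
  unfolding poly_bounded_def by (metis mult_le_mono poly_mult)

text \<open>The bound is the running time with \<open>n\<close>, \<open>k\<close> and the word
  length replaced by \<open>x\<close>; 41 is the 40 of \<open>row_time\<close> plus one loop test,
  and 12 is the 10 of \<open>sweep_time\<close> plus the 2 added per sweep in
  \<open>total_time\<close>.\<close>

lemma total_time_le:
  assumes "n \<le> x" "k \<le> x" "length (instance_tape.input_word n k adj) = x"
  shows "instance_tape.total_time n k adj \<le>
    30 * x + 6 * (x * x) + 20 * x + 2 * x + 60 +
    x * (x * (x * (7 * x + 30) + 41) + 6 * x + 2 * x + 12) + 10 * (x * x) + 40 * x + 10 * x + 2 * x + 50"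
proof -
  have "n * n \<le> x * x" using assms by (intro mult_le_mono)
  moreover have "n * (instance_tape.sweep_time n k adj + 2) \<le>
      x * (x * (x * (7 * x + 30) + 41) + 6 * x + 2 * x + 12)"
  proof (rule mult_le_mono[OF assms(1)])
    have "n * (7 * k + 30) \<le> x * (7 * x + 30)"
      using assms by (intro mult_le_mono) auto
    then have "n * Suc (instance_tape.row_time n k) \<le> x * (x * (7 * x + 30) + 41)"
      using assms by (intro mult_le_mono) (auto simp: instance_tape.row_time_def)
    then show "instance_tape.sweep_time n k adj + 2 \<le> x * (x * (7 * x + 30) + 41) + 6 * x + 2 * x + 12"
      using assms by (simp add: instance_tape.sweep_time_def)
  qed
  ultimately show ?thesis
    using assms by (simp only: instance_tape.total_time_def instance_tape.init_time_def)
qed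

lemma length_input_word_ge:
  "n \<le> length (instance_tape.input_word n k adj)" "k \<le> length (instance_tape.input_word n k adj)"
  by (simp_all add: instance_tape.length_input_word)

theorem theorem10:
  "encode_problem enc_input enc_output
     (Rel Dominating_Set dist_E_param (\<lambda>n. ennreal (real n / exp 1))) \<in> FP"
proof -
  let ?P = "Rel Dominating_Set dist_E_param (\<lambda>n. ennreal (real n / exp 1))"
  let ?M = "compile 9 5 domination_prog"
  have "poly_bounded (\<lambda>x. 30 * x + 6 * (x * x) + 20 * x + 2 * x + 60 +
    x * (x * (x * (7 * x + 30) + 41) + 6 * x + 2 * x + 12) + 10 * (x * x) + 40 * x + 10 * x + 2 * x + 50)"
    by (intro poly_bounded_add poly_bounded_mult poly_bounded_const poly_bounded_id)
  then obtain p :: "nat poly" where p: "\<And>x. 30 * x + 6 * (x * x) + 20 * x + 2 * x + 60 +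
    x * (x * (x * (7 * x + 30) + 41) + 6 * x + 2 * x + 12) + 10 * (x * x) + 40 * x + 10 * x + 2 * x + 50
    \<le> poly p x" by (auto simp: poly_bounded_def)
  have inputs: "inputs ?P = graph_inputs"
    by (simp add: Rel_def Dominating_Set_def search_problem_def)
  have "wf_tm ?M" by (rule wf_compile[OF wf_domination_prog]) auto
  moreover have "\<exists>y. correct (encode_problem enc_input enc_output ?P) (enc_input I) y \<and>
      outputs_within ?M (enc_input I) (poly p (length (enc_input I))) y" if I: "I \<in> graph_inputs" for I
  proof -
    obtain G k where Gk: "I = (G, k)" by (metis surj_pair)
    define n where "n = card (verts G)"
    define adj where "adj = (\<lambda>i j. {i, j} \<in> edges G)"
    interpret instance_tape n k adj .
    have word: "input_word = enc_input I"
      unfolding input_word_def unfolding adj_def n_def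
      by (simp add: enc_input_def enc_graph_def enc_nat_def Gk Let_def)
    obtain J a where Ja: "output_word = enc_output (J, a)" "correct ?P I (J, a)"
      using greedy_output_correct[of G k] I unfolding Gk n_def adj_def by blast
    have "total_time \<le> poly p (length input_word)"
      using total_time_le[OF length_input_word_ge refl] p order_trans by blast
    then have "outputs_within ?M input_word (poly p (length input_word)) output_word"
      using domination_prog_outputs outputs_within_mono by blast
    moreover have "correct (encode_problem enc_input enc_output ?P) (enc_input I) output_word"
      using I Ja by (simp only: encode_problem_def inputs problem.simps) blast
    ultimately show ?thesis using word by auto
  qed
  moreover have "inputs (encode_problem enc_input enc_output ?P) = enc_input ` graph_inputs"
    by (simp add: encode_problem_def inputs)
  ultimately show ?thesis
    unfolding FP_def mem_Collect_eq by (intro exI[of _ ?M] exI[of _ p]) (simp only: ball_simps, blast)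
qed

end
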